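(* Let $d\ge1$, let $p\in(p_d,1]$ where $p_d:=\frac{2d+1}{4d}$, and let $S$ be a multi-dimensional elephant random walk on $\mathbb{Z}^d$ with parameter $p$. Let $Y_d:=\lim_{n\to\infty} S_n/n^{a}$ (almost sure limit), where $a:=\frac{2dp-1}{2d-1}$. Then $\mathbb{P}(Y_d=0)=0$. In particular, $S$ is transient.
   Context: Multi-dimensional elephant random walk (MERW): let $e_1,\dots,e_d$ be the standard basis of $\mathbb{R}^d$ and $p\in[0,1]$. Set $S_0=0$ and $S_1=\sigma_1=e_1$. For each $n\ge 1$, choose $n'$ uniformly at random in $\{1,\dots,n\}$ (independently of the past); given the past and $n'$, let $\sigma_{n+1}=\sigma_{n'}$ with probability $p$, and $\sigma_{n+1}=\sigma$ with probability $\frac{1-p}{2d-1}$ for each $\sigma\in\{\pm e_1,\dots,\pm e_d\}\setminus\{\sigma_{n'}\}$. Set $S_{n+1}=S_n+\sigma_{n+1}$. It is a known result (Bercu; Coletti–Gava–Schütz; Bercu–Laulin) that for $p>p_d$ the sequence $S_n/n^{a}$ converges almost surely to an $\mathbb{R}^d$-valued random vector $Y_d$. A random walk $(S_n)$ on $\mathbb{Z}^d$ is called transient if for every $x\in\mathbb{Z}^d$, $\mathbb{P}(S_n=x\text{ for only finitely many }n)=1$. *)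

theory Defs
  imports "HOL-Probability.Probability"
begin

definition unit_steps :: "(real^'d) set" where
  "unit_steps = (\<Union>i. {axis i 1, - axis i 1})"

definition walk :: "(nat \<Rightarrow> 'w \<Rightarrow> real^'d) \<Rightarrow> nat \<Rightarrow> 'w \<Rightarrow> real^'d" where
  "walk \<sigma> n \<omega> = (\<Sum>i=1..n. \<sigma> i \<omega>)"

text \<open>
  \<^term>\<open>\<tau> n\<close> is the time in \<open>{1..n}\<close> that the elephant remembers when it makes
  step \<^term>\<open>Suc n\<close> (it is written \<open>n'\<close> informally).  The past at that moment consists of
  all the randomness used so far: the steps \<open>\<sigma> 1, \<dots>, \<sigma> n\<close> and the
  earlier choices \<open>\<tau> 1, \<dots>, \<tau> (n - 1)\<close>.  The values \<open>\<sigma> 0\<close> and \<open>\<tau> 0\<close> play no role.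
\<close>

definition past ::
  "(nat \<Rightarrow> 'w \<Rightarrow> nat) \<Rightarrow> (nat \<Rightarrow> 'w \<Rightarrow> real^'d) \<Rightarrow> nat \<Rightarrow> 'w \<Rightarrow> (nat \<Rightarrow> real^'d) \<times> (nat \<Rightarrow> nat)" where
  "past \<tau> \<sigma> n \<omega> = ((\<lambda>i\<in>{1..n}. \<sigma> i \<omega>), (\<lambda>i\<in>{1..<n}. \<tau> i \<omega>))"

definition past_space :: "nat \<Rightarrow> ((nat \<Rightarrow> real^'d) \<times> (nat \<Rightarrow> nat)) measure" where
  "past_space n = (\<Pi>\<^sub>M i\<in>{1..n}. borel) \<Otimes>\<^sub>M (\<Pi>\<^sub>M i\<in>{1..<n}. count_space UNIV)"

text \<open>
  The index type \<^typ>\<open>'d\<close> carries no order, so the coordinate of the initial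
  step \<open>e\<^sub>1\<close> is an arbitrary fixed index \<^term>\<open>k\<close>.

  All the variables are discrete, so the law of step \<^term>\<open>Suc n\<close> given the past and the
  remembered time is stated as an elementary conditional probability, given each
  possible value \<^term>\<open>(s, t)\<close> of the past and \<^term>\<open>j\<close> of the remembered time.  As
  \<^const>\<open>cond_prob\<close> is \<open>0\<close> by convention when the condition has probability \<open>0\<close>,
  only conditions of positive probability are considered.
\<close>

locale elephant_random_walk = prob_space M
  for M :: "'w measure" +
  fixes p :: real
    and k :: "'d::finite"
    and \<tau> :: "nat \<Rightarrow> 'w \<Rightarrow> nat"
    and \<sigma> :: "nat \<Rightarrow> 'w \<Rightarrow> real^'d"
  assumes p_range: "0 \<le> p" "p \<le> 1"
    and measurable_memory: "\<And>n. 1 \<le> n \<Longrightarrow> random_variable (count_space UNIV) (\<tau> n)"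
    and measurable_step: "\<And>n. 1 \<le> n \<Longrightarrow> random_variable borel (\<sigma> n)"
    and first_step: "\<And>\<omega>. \<omega> \<in> space M \<Longrightarrow> \<sigma> 1 \<omega> = axis k 1"
    and memory_uniform:
      "\<And>n. 1 \<le> n \<Longrightarrow> distr M (count_space UNIV) (\<tau> n) = measure_pmf (pmf_of_set {1..n})"
    and memory_indep:
      "\<And>n. 1 \<le> n \<Longrightarrow>
        indep_set (sets (vimage_algebra (space M) (past \<tau> \<sigma> n) (past_space n)))
                  (sets (vimage_algebra (space M) (\<tau> n) (count_space UNIV)))"
    and next_step:
      "\<And>n s t j v. 1 \<le> n \<Longrightarrow> j \<in> {1..n} \<Longrightarrow> v \<in> unit_steps \<Longrightarrow>
        \<P>(\<omega> in M. past \<tau> \<sigma> n \<omega> = (s, t) \<and> \<tau> n \<omega> = j) > 0 \<Longrightarrow>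
        \<P>(\<omega> in M. \<sigma> (Suc n) \<omega> = v \<bar> past \<tau> \<sigma> n \<omega> = (s, t) \<and> \<tau> n \<omega> = j)
          = (if v = s j then p else (1 - p) / (2 * real CARD('d) - 1))"

definition critical_param :: "nat \<Rightarrow> real" where
  "critical_param d = (2 * real d + 1) / (4 * real d)"

definition scaling_exponent :: "nat \<Rightarrow> real \<Rightarrow> real" where
  "scaling_exponent d p = (2 * real d * p - 1) / (2 * real d - 1)"

definition rescaled_walk :: "real \<Rightarrow> (nat \<Rightarrow> 'w \<Rightarrow> real^'d) \<Rightarrow> nat \<Rightarrow> 'w \<Rightarrow> real^'d" where
  "rescaled_walk p \<sigma> n \<omega> = walk \<sigma> n \<omega> /\<^sub>R (real n powr scaling_exponent CARD('d) p)"

text \<open>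
  \<^const>\<open>lim\<close> is total: this is the limit only at those \<^term>\<open>\<omega>\<close> where the rescaled walk converges.
\<close>

definition limit_vector :: "real \<Rightarrow> (nat \<Rightarrow> 'w \<Rightarrow> real^'d) \<Rightarrow> 'w \<Rightarrow> real^'d" where
  "limit_vector p \<sigma> \<omega> = lim (\<lambda>n. rescaled_walk p \<sigma> n \<omega>)"

definition transient :: "'w measure \<Rightarrow> (nat \<Rightarrow> 'w \<Rightarrow> real^'d) \<Rightarrow> bool" where
  "transient M S \<longleftrightarrow>
    (\<forall>x. (\<forall>i. x $ i \<in> \<int>) \<longrightarrow> \<P>(\<omega> in M. finite {n. S n \<omega> = x}) = 1)"

end

theory Submission
  imports Defs "HOL-Real_Asymp.Real_Asymp"
begin

text \<open>
  The coordinates of the walk are treated one at a time.  Write \<open>X n\<close> for a coordinate of the walk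
  and \<open>a\<close> for the scaling exponent.  Since the unit steps have mean zero, the next step has conditional mean
  \<open>a * X n / n\<close>, whatever the coordinate.  So \<open>X n\<close> divided by the product \<open>growth a n\<close> of the
  factors \<open>1 + a / k\<close> is a martingale.  The condition on \<open>p\<close> says \<open>a > 1 / 2\<close>; then
  \<open>E (X n)\<^sup>2\<close> is at most of order \<open>n powr (2 * a)\<close>, the martingale is bounded in \<open>L\<^sup>2\<close> and converges almost surely
  (\<open>L2_bounded_convergent\<close>, by Kolmogorov's maximal inequality).  As \<open>growth a n\<close> has exact order
  \<open>n powr a\<close>, the rescaled walk converges as well.

  The limit \<open>Y\<close> of a coordinate is almost surely nonzero when \<open>p < 1\<close>, because no past can predict
  that the later noise will cancel the position exactly on the scale of its growth.  Given the past at
  time \<open>n\<close>, the square \<open>(X N)\<^sup>2\<close> has, for large \<open>N\<close>, conditional mean at least a constant multiple of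
  \<open>growth (2 * a) N / growth (2 * a) n * ((X n)\<^sup>2 + n)\<close>, since every step keeps some noise, and conditional second moment at most a constant multiple of the square of this quantity
  (\<open>second_moment_lower\<close>, \<open>fourth_moment_upper\<close>).  A Paley--Zygmund argument then bounds the
  conditional probability of \<open>Y \<noteq> 0\<close> below by a constant independent of \<open>n\<close> and of the past
  (\<open>escape_from_stage\<close>).  Since \<open>Y\<close> is approximated by functions of the past, such a uniform bound
  is only compatible with \<open>Y \<noteq> 0\<close> almost surely (\<open>limit_nonzero\<close>).  For \<open>p = 1\<close> the walk is
  deterministic up to null sets and keeps moving in the direction of its first step (\<open>limit_full_memory\<close>).

  Transience follows: if the walk visits a point infinitely often, the rescaled walk has a
  subsequence tending to \<open>0\<close>, so its limit is \<open>0\<close>.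

  The walk enters only through its finitely many possible pasts, so conditional expectations are
  expressed by testing against functions of the past, and the identities they satisfy are finite
  sums over \<open>outcomes n\<close> (\<open>next_step_expectation\<close>).
\<close>

section \<open>Martingales on an essentially finite filtration\<close>

text \<open>
  Up to null sets the walk has only finitely many possible pasts at each time.
  Requiring every function measurable at some stage to be integrable captures
  exactly this, and removes all boundedness side conditions below.
\<close>

locale finite_filtration = prob_space M for M :: "'w measure" +
  fixes F :: "nat \<Rightarrow> 'w measure"
  assumes subalg: "\<And>n. subalgebra M (F n)"
    and filtration_mono: "\<And>m n. m \<le> n \<Longrightarrow> subalgebra (F n) (F m)"
    and integrable_stage: "\<And>n g. g \<in> borel_measurable (F n) \<Longrightarrow> integrable M (g :: 'w \<Rightarrow> real)"
begin

lemma measurable_mono: "g \<in> borel_measurable (F m) \<Longrightarrow> m \<le> n \<Longrightarrow> g \<in> borel_measurable (F n)"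
  using measurable_from_subalg[OF filtration_mono] by blast

lemma measurable_top: "g \<in> borel_measurable (F m) \<Longrightarrow> g \<in> borel_measurable M"
  using measurable_from_subalg[OF subalg] by blast

lemma space_F: "space (F n) = space M"
  using subalg by (auto simp: subalgebra_def)

end

locale finite_martingale = finite_filtration M F for M :: "'w measure" and F +
  fixes Z :: "nat \<Rightarrow> 'w \<Rightarrow> real"
  assumes adapted: "\<And>n. 1 \<le> n \<Longrightarrow> Z n \<in> borel_measurable (F n)"
    and fair: "\<And>n g. 1 \<le> n \<Longrightarrow> g \<in> borel_measurable (F n) \<Longrightarrow>
          expectation (\<lambda>\<omega>. g \<omega> * (Z (Suc n) \<omega> - Z n \<omega>)) = 0"
begin

lemma adapted_le: "1 \<le> m \<Longrightarrow> m \<le> n \<Longrightarrow> Z m \<in> borel_measurable (F n)"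
  using adapted measurable_mono by blast

text \<open>
  The cross term of \<open>Z (Suc n) - c = (Z n - c) + (Z (Suc n) - Z n)\<close> has mean zero,
  because its first factor is known at stage \<open>n\<close>.
\<close>

lemma square_step:
  assumes n: "1 \<le> n" and [measurable]: "g \<in> borel_measurable (F n)" "c \<in> borel_measurable (F n)"
  shows "expectation (\<lambda>\<omega>. g \<omega> * (Z (Suc n) \<omega> - c \<omega>)\<^sup>2) =
    expectation (\<lambda>\<omega>. g \<omega> * (Z n \<omega> - c \<omega>)\<^sup>2) + expectation (\<lambda>\<omega>. g \<omega> * (Z (Suc n) \<omega> - Z n \<omega>)\<^sup>2)"
proof -
  note [measurable] = adapted[OF n]
  have [measurable]: "Z (Suc n) \<in> borel_measurable (F (Suc n))" by (rule adapted) simp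
  have [measurable]: "g \<in> borel_measurable (F (Suc n))" "c \<in> borel_measurable (F (Suc n))"
    "Z n \<in> borel_measurable (F (Suc n))"
    using measurable_mono[OF assms(2), of "Suc n"] measurable_mono[OF assms(3), of "Suc n"]
      adapted_le[OF n, of "Suc n"] by auto
  have eq: "g \<omega> * (Z (Suc n) \<omega> - c \<omega>)\<^sup>2 =
     g \<omega> * (Z n \<omega> - c \<omega>)\<^sup>2 + g \<omega> * (Z (Suc n) \<omega> - Z n \<omega>)\<^sup>2
     + (2 * g \<omega> * (Z n \<omega> - c \<omega>)) * (Z (Suc n) \<omega> - Z n \<omega>)" for \<omega>
    by (simp add: power2_eq_square algebra_simps)
  have i: "integrable M (\<lambda>\<omega>. g \<omega> * (Z n \<omega> - c \<omega>)\<^sup>2)"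
    "integrable M (\<lambda>\<omega>. g \<omega> * (Z (Suc n) \<omega> - Z n \<omega>)\<^sup>2)"
    "integrable M (\<lambda>\<omega>. (2 * g \<omega> * (Z n \<omega> - c \<omega>)) * (Z (Suc n) \<omega> - Z n \<omega>))"
    by (rule integrable_stage[of _ "Suc n"], measurable)+
  have "expectation (\<lambda>\<omega>. (2 * g \<omega> * (Z n \<omega> - c \<omega>)) * (Z (Suc n) \<omega> - Z n \<omega>)) = 0"
    by (rule fair[OF n]) measurable
  then show ?thesis unfolding eq using i by simp
qed

lemma square_increment:
  assumes n: "1 \<le> n" "n \<le> N"
  shows "expectation (\<lambda>\<omega>. (Z N \<omega> - Z n \<omega>)\<^sup>2) =
    expectation (\<lambda>\<omega>. (Z N \<omega>)\<^sup>2) - expectation (\<lambda>\<omega>. (Z n \<omega>)\<^sup>2)"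
  using n(2)
proof (induction N rule: dec_induct)
  case base then show ?case by simp
next
  case (step m)
  have m: "1 \<le> m" using n step by simp
  show ?case
    using square_step[OF m, of "\<lambda>_. 1" "Z n"] square_step[OF m, of "\<lambda>_. 1" "\<lambda>_. 0"]
      adapted_le[OF n(1) step(1)] step.IH by simp
qed

lemma square_mono:
  assumes "1 \<le> n" "n \<le> N"
  shows "expectation (\<lambda>\<omega>. (Z n \<omega>)\<^sup>2) \<le> expectation (\<lambda>\<omega>. (Z N \<omega>)\<^sup>2)"
proof -
  have "0 \<le> expectation (\<lambda>\<omega>. (Z N \<omega> - Z n \<omega>)\<^sup>2)" by (rule Bochner_Integration.integral_nonneg) simp
  then show ?thesis using square_increment[OF assms] by simp
qed

text \<open>
  Doob's inequality in Kolmogorov's form.  It is proved by induction on the horizon: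
  on the event \<open>A m\<close> that the level has already been crossed, the second moment
  of the deviation can only grow when time advances; on the event \<open>B\<close> of a first
  crossing at time \<open>Suc m\<close> the deviation exceeds \<open>l\<close> by definition.
\<close>

lemma maximal_inequality:
  assumes n: "1 \<le> n" "n \<le> N" and l: "0 < l"
  shows "l\<^sup>2 * \<P>(\<omega> in M. \<exists>i\<in>{n..N}. l < \<bar>Z i \<omega> - Z n \<omega>\<bar>)
    \<le> expectation (\<lambda>\<omega>. (Z N \<omega>)\<^sup>2) - expectation (\<lambda>\<omega>. (Z n \<omega>)\<^sup>2)"
proof -
  define A where "A N = {\<omega>\<in>space M. \<exists>i\<in>{n..N}. l < \<bar>Z i \<omega> - Z n \<omega>\<bar>}" for N
  have A_F[measurable]: "A N \<in> sets (F N)" if "n \<le> N" for N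
  proof -
    have [measurable]: "Z i \<in> borel_measurable (F N)" if "i \<in> {n..N}" for i
      using that n by (intro adapted_le) auto
    have [measurable]: "Z n \<in> borel_measurable (F N)" using that n by (intro adapted_le) auto
    have "A N = {\<omega>\<in>space (F N). \<exists>i\<in>{n..N}. l < \<bar>Z i \<omega> - Z n \<omega>\<bar>}"
      by (simp add: A_def space_F)
    also have "\<dots> \<in> sets (F N)" by measurable
    finally show ?thesis .
  qed
  have int_stage: "integrable M (\<lambda>\<omega>. indicator B \<omega> * (Z N \<omega> - Z n \<omega>)\<^sup>2)"
    if "n \<le> N" "B \<in> sets (F N)" for B N
  proof -
    note [measurable] = that(2)
    have [measurable]: "Z N \<in> borel_measurable (F N)" "Z n \<in> borel_measurable (F N)"
      using that n by (auto intro: adapted_le)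
    show ?thesis by (rule integrable_stage[of _ N]) measurable
  qed
  have AM: "A N \<in> sets M" if "n \<le> N" for N
    using A_F[OF that] subalg by (auto simp: subalgebra_def)
  have key: "l\<^sup>2 * prob (A N) \<le> expectation (\<lambda>\<omega>. indicator (A N) \<omega> * (Z N \<omega> - Z n \<omega>)\<^sup>2)"
    using n(2)
  proof (induction N rule: dec_induct)
    case base
    have "A n = {}" using l by (auto simp: A_def)
    then show ?case by simp
  next
    case (step m)
    have m: "1 \<le> m" using n step by simp
    define B where "B = A (Suc m) - A m"
    have Am: "A m \<in> sets (F (Suc m))"
      using A_F[OF step(1)] filtration_mono[of m "Suc m"] by (auto simp: subalgebra_def)
    have BF: "B \<in> sets (F (Suc m))" using Am A_F[of "Suc m"] step by (auto simp: B_def)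
    have BM: "B \<in> sets M" using BF subalg by (auto simp: subalgebra_def)
    have sub: "A m \<subseteq> A (Suc m)" by (auto simp: A_def)
    have dis: "A (Suc m) = A m \<union> B" "A m \<inter> B = {}" using sub by (auto simp: B_def)
    have ind: "indicator (A (Suc m)) \<omega> = indicator (A m) \<omega> + (indicator B \<omega> :: real)" for \<omega>
      using dis by (auto simp: indicator_def)
    have B_big: "l\<^sup>2 * indicator B \<omega> \<le> indicator B \<omega> * (Z (Suc m) \<omega> - Z n \<omega>)\<^sup>2" for \<omega>
    proof (cases "\<omega> \<in> B")
      case True
      then have "l < \<bar>Z (Suc m) \<omega> - Z n \<omega>\<bar>" by (auto simp: B_def A_def le_Suc_eq)
      then have "l\<^sup>2 \<le> \<bar>Z (Suc m) \<omega> - Z n \<omega>\<bar>\<^sup>2" using l by (intro power_mono) auto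
      then show ?thesis using True by simp
    qed simp
    have "l\<^sup>2 * prob B = expectation (\<lambda>\<omega>. l\<^sup>2 * indicator B \<omega>)"
      using BM by simp
    also have "\<dots> \<le> expectation (\<lambda>\<omega>. indicator B \<omega> * (Z (Suc m) \<omega> - Z n \<omega>)\<^sup>2)"
      using BM B_big int_stage[OF _ BF] step
      by (intro integral_mono integrable_mult_right integrable_real_indicator)
        (auto simp: emeasure_eq_measure)
    finally have b: "l\<^sup>2 * prob B \<le> expectation (\<lambda>\<omega>. indicator B \<omega> * (Z (Suc m) \<omega> - Z n \<omega>)\<^sup>2)" .
    have "expectation (\<lambda>\<omega>. indicator (A m) \<omega> * (Z m \<omega> - Z n \<omega>)\<^sup>2)
       \<le> expectation (\<lambda>\<omega>. indicator (A m) \<omega> * (Z (Suc m) \<omega> - Z n \<omega>)\<^sup>2)"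
    proof -
      have "0 \<le> expectation (\<lambda>\<omega>. indicator (A m) \<omega> * (Z (Suc m) \<omega> - Z m \<omega>)\<^sup>2)"
        by (rule Bochner_Integration.integral_nonneg) simp
      then show ?thesis
        using square_step[OF m, of "indicator (A m)" "Z n"] adapted_le[OF n(1) step(1)] A_F[OF step(1)]
        by simp
    qed
    then have "l\<^sup>2 * prob (A m) \<le> expectation (\<lambda>\<omega>. indicator (A m) \<omega> * (Z (Suc m) \<omega> - Z n \<omega>)\<^sup>2)"
      using step.IH by simp
    moreover have "prob (A (Suc m)) = prob (A m) + prob B"
      unfolding dis(1) using dis(2) AM[OF step(1)] BM by (intro finite_measure_Union) auto
    moreover have "expectation (\<lambda>\<omega>. indicator (A (Suc m)) \<omega> * (Z (Suc m) \<omega> - Z n \<omega>)\<^sup>2)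
      = expectation (\<lambda>\<omega>. indicator (A m) \<omega> * (Z (Suc m) \<omega> - Z n \<omega>)\<^sup>2)
      + expectation (\<lambda>\<omega>. indicator B \<omega> * (Z (Suc m) \<omega> - Z n \<omega>)\<^sup>2)"
      unfolding ind distrib_right
      using int_stage[OF _ BF] int_stage[OF _ Am] step by (intro Bochner_Integration.integral_add) auto
    ultimately show ?case using b by (simp add: distrib_left)
  qed
  also have "\<dots> \<le> expectation (\<lambda>\<omega>. (Z N \<omega> - Z n \<omega>)\<^sup>2)"
  proof (rule integral_mono)
    show "integrable M (\<lambda>\<omega>. indicator (A N) \<omega> * (Z N \<omega> - Z n \<omega>)\<^sup>2)"
      by (rule int_stage[OF n(2) A_F[OF n(2)]])
    have [measurable]: "Z N \<in> borel_measurable (F N)" "Z n \<in> borel_measurable (F N)"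
      using n by (auto intro: adapted_le)
    show "integrable M (\<lambda>\<omega>. (Z N \<omega> - Z n \<omega>)\<^sup>2)"
      by (rule integrable_stage[of _ N]) measurable
  qed (simp add: indicator_def)
  finally show ?thesis unfolding A_def using square_increment[OF n] by simp
qed

text \<open>
  The second moments increase to a limit \<open>L\<close>, so by the maximal inequality the
  probability of an oscillation by more than \<open>l\<close> after time \<open>n\<close> is at most
  \<open>(L - E (Z n)\<^sup>2) / l\<^sup>2\<close> up to an index shift, which tends to \<open>0\<close>.  Hence almost every path is Cauchy.
\<close>

theorem L2_bounded_convergent:
  assumes bound: "\<And>n. 1 \<le> n \<Longrightarrow> expectation (\<lambda>\<omega>. (Z n \<omega>)\<^sup>2) \<le> C"
  shows "AE \<omega> in M. convergent (\<lambda>n. Z n \<omega>)"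
proof -
  define e where "e n = expectation (\<lambda>\<omega>. (Z (Suc n) \<omega>)\<^sup>2)" for n
  have e_mono: "incseq e" unfolding e_def by (intro incseq_SucI square_mono) auto
  obtain L where L: "e \<longlonglongrightarrow> L" "\<And>n. e n \<le> L"
    using incseq_convergent[OF e_mono, of C] bound unfolding e_def by auto
  have Zm[measurable]: "Z (Suc n) \<in> borel_measurable M" for n
    by (rule measurable_top[OF adapted]) simp
  have osc: "AE \<omega> in M. \<exists>n. \<forall>i\<ge>n. \<bar>Z (Suc i) \<omega> - Z (Suc n) \<omega>\<bar> \<le> l" if l: "0 < l" for l :: real
  proof -
    define B where "B n = {\<omega>\<in>space M. \<exists>i\<ge>n. l < \<bar>Z (Suc i) \<omega> - Z (Suc n) \<omega>\<bar>}" for n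
    have Bm[measurable]: "B n \<in> sets M" for n unfolding B_def by measurable
    have B_le: "prob (B n) \<le> (L - e n) / l\<^sup>2" for n
    proof -
      define D where "D N = {\<omega>\<in>space M. \<exists>i\<in>{Suc n..Suc (n + N)}. l < \<bar>Z i \<omega> - Z (Suc n) \<omega>\<bar>}" for N
      have D_eq: "D N = {\<omega>\<in>space M. \<exists>i\<in>{n..n + N}. l < \<bar>Z (Suc i) \<omega> - Z (Suc n) \<omega>\<bar>}" for N
        unfolding D_def by (metis (no_types, opaque_lifting) image_Suc_atLeastAtMost image_iff)
      have "D N \<in> sets M" for N unfolding D_eq by measurable
      moreover have "incseq D" unfolding D_def by (intro incseq_SucI) auto
      moreover have "(\<Union>N. D N) = B n"
      proof (intro equalityI subsetI)
        fix \<omega> assume "\<omega> \<in> B n"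
        then obtain i where "\<omega> \<in> space M" "i \<ge> n" "l < \<bar>Z (Suc i) \<omega> - Z (Suc n) \<omega>\<bar>"
          by (auto simp: B_def)
        then have "\<omega> \<in> D (i - n)" unfolding D_eq by auto
        then show "\<omega> \<in> (\<Union>N. D N)" by blast
      qed (auto simp: D_eq B_def)
      ultimately have "(\<lambda>N. prob (D N)) \<longlonglongrightarrow> prob (B n)"
        using finite_Lim_measure_incseq[of D] by auto
      moreover have "prob (D N) \<le> (L - e n) / l\<^sup>2" for N
      proof -
        have "l\<^sup>2 * prob (D N) \<le> e (n + N) - e n"
          unfolding e_def D_def using l by (intro maximal_inequality) auto
        also have "\<dots> \<le> L - e n" using L by simp
        finally show ?thesis using l by (simp add: field_simps)
      qed
      ultimately show ?thesis by (intro LIMSEQ_le_const2) auto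
    qed
    have "prob (\<Inter>n. B n) \<le> (L - e n) / l\<^sup>2" for n
      using finite_measure_mono[of "\<Inter>n. B n" "B n"] B_le[of n] by (meson INF_lower Bm order_trans iso_tuple_UNIV_I)
    moreover have "(\<lambda>n. (L - e n) / l\<^sup>2) \<longlonglongrightarrow> (L - L) / l\<^sup>2"
      using l by (intro tendsto_intros L) auto
    ultimately have "prob (\<Inter>n. B n) \<le> 0"
      by (intro LIMSEQ_le_const[of "\<lambda>n. (L - e n) / l\<^sup>2"]) auto
    then have "prob (\<Inter>n. B n) = 0" using measure_nonneg[of M] by (metis order_antisym)
    then have "AE \<omega> in M. \<omega> \<notin> (\<Inter>n. B n)"
      by (subst (asm) prob_eq_0) auto
    then show ?thesis
      using AE_space by eventually_elim (auto simp: B_def not_less)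
  qed
  have "AE \<omega> in M. \<forall>m. \<exists>n. \<forall>i\<ge>n. \<bar>Z (Suc i) \<omega> - Z (Suc n) \<omega>\<bar> \<le> inverse (real (Suc m))"
    unfolding AE_all_countable by (intro allI osc) simp
  then show ?thesis
  proof eventually_elim
    case (elim \<omega>)
    have "Cauchy (\<lambda>n. Z (Suc n) \<omega>)"
    proof (rule metric_CauchyI)
      fix r :: real assume "0 < r"
      then obtain m where m: "inverse (real (Suc m)) < r / 2" using reals_Archimedean[of "r/2"] by auto
      obtain n where n: "\<And>i. i \<ge> n \<Longrightarrow> \<bar>Z (Suc i) \<omega> - Z (Suc n) \<omega>\<bar> \<le> inverse (real (Suc m))"
        using elim by blast
      have "dist (Z (Suc i) \<omega>) (Z (Suc j) \<omega>) < r" if "i \<ge> n" "j \<ge> n" for i j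
        using n[OF that(1)] n[OF that(2)] m unfolding dist_real_def by linarith
      then show "\<exists>N. \<forall>i\<ge>N. \<forall>j\<ge>N. dist (Z (Suc i) \<omega>) (Z (Suc j) \<omega>) < r" by blast
    qed
    then have "convergent (\<lambda>n. Z (Suc n) \<omega>)" by (rule Cauchy_convergent)
    then show ?case by (simp add: convergent_Suc_iff[of "\<lambda>n. Z n \<omega>"])
  qed
qed

end

section \<open>Product growth factors\<close>

text \<open>
  The factor by which a quantity grows up to time \<open>n\<close> when its conditional mean is
  multiplied by \<open>1 + c / k\<close> at each time \<open>k\<close>.  It is \<open>\<Gamma> (n + c) / (\<Gamma> n \<Gamma> (1 + c))\<close>, hence
  of exact order \<open>n powr c\<close>.
\<close>

definition growth :: "real \<Rightarrow> nat \<Rightarrow> real" where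
  "growth c n = (\<Prod>k=1..<n. 1 + c / real k)"

lemma growth_1: "growth c (Suc 0) = 1"
  by (simp add: growth_def)

lemma growth_Suc: "1 \<le> n \<Longrightarrow> growth c (Suc n) = growth c n * (1 + c / real n)"
  by (simp add: growth_def prod.atLeastLessThan_Suc)

lemma growth_pos: "0 \<le> c \<Longrightarrow> 0 < growth c n"
  unfolding growth_def by (intro prod_pos) (auto intro: add_pos_nonneg)

text \<open>
  For \<open>c = a\<close> this turns the bound \<open>growth (2 * a) n\<close> on the second moment of the walk
  into a uniform second-moment bound for the martingale obtained by dividing
  the walk by \<open>growth a n\<close>.
\<close>

lemma growth_double_le: "0 \<le> c \<Longrightarrow> growth (2 * c) n \<le> (growth c n)\<^sup>2"
  unfolding growth_def power2_eq_square prod.distrib[symmetric]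
  by (intro prod_mono) (auto simp: field_simps)

text \<open>
  This identifies \<open>growth c\<close> with the reciprocal of Euler's product sequence
  \<open>Gamma_series\<close>, whose limit is the Gamma function.
\<close>

lemma pochhammer_growth: "pochhammer c (Suc n) = c * fact n * growth c (Suc n)"
proof (induction n)
  case 0 then show ?case by (simp add: growth_1)
next
  case (Suc n)
  have "pochhammer c (Suc (Suc n)) = pochhammer c (Suc n) * (c + real (Suc n))"
    by (simp only: pochhammer_Suc)
  also have "\<dots> = c * fact n * growth c (Suc n) * (real (Suc n) * (1 + c / real (Suc n)))"
    unfolding Suc by (simp add: field_simps)
  also have "\<dots> = c * fact (Suc n) * growth c (Suc (Suc n))"
    using growth_Suc[of "Suc n" c] by (simp add: mult_ac del: of_nat_Suc)
  finally show ?case .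
qed

lemma growth_asymptotics:
  assumes c: "0 < c"
  shows "\<exists>L>0. (\<lambda>n. growth c n / real n powr c) \<longlonglongrightarrow> L"
proof (intro exI conjI)
  have G: "Gamma c > 0" using c by (rule Gamma_real_pos)
  then show "0 < 1 / (c * Gamma c)" using c by simp
  have "(\<lambda>n. 1 / (c * Gamma_series c n)) \<longlonglongrightarrow> 1 / (c * Gamma c)"
    by (rule tendsto_divide[OF tendsto_const tendsto_mult[OF tendsto_const Gamma_series_LIMSEQ]])
      (use G c in \<open>metis less_irrefl mult_eq_0_iff\<close>)
  moreover have "(\<lambda>n. real n powr c / real (Suc n) powr c) \<longlonglongrightarrow> 1"
    using c by real_asymp
  ultimately have "(\<lambda>n. 1 / (c * Gamma_series c n) * (real n powr c / real (Suc n) powr c))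
      \<longlonglongrightarrow> 1 / (c * Gamma c) * 1" by (rule tendsto_mult)
  moreover have "eventually (\<lambda>n. 1 / (c * Gamma_series c n) * (real n powr c / real (Suc n) powr c)
      = growth c (Suc n) / real (Suc n) powr c) sequentially"
    using eventually_gt_at_top[of 0]
  proof eventually_elim
    case (elim n)
    have "exp (c * ln (real n)) = real n powr c" using elim by (simp add: powr_def)
    then have "Gamma_series c n = real n powr c / (c * growth c (Suc n))"
      using c pochhammer_growth[of c n] unfolding Gamma_series_def by simp
    moreover have "growth c (Suc n) > 0" "real n powr c > 0" using c elim by (auto intro: growth_pos)
    ultimately show ?case using c by simp
  qed
  ultimately have "(\<lambda>n. growth c (Suc n) / real (Suc n) powr c) \<longlonglongrightarrow> 1 / (c * Gamma c)"
    by (auto elim: Lim_transform_eventually)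
  then show "(\<lambda>n. growth c n / real n powr c) \<longlonglongrightarrow> 1 / (c * Gamma c)"
    by (rule LIMSEQ_imp_Suc)
qed

section \<open>Moments of a linearly reinforced walk\<close>

text \<open>
  What one coordinate of an elephant random walk looks like: bounded steps, a linear
  drift \<open>a X n / n\<close>, and conditional second moments of the steps bounded below by \<open>v\<close>.
  Conditional expectations are expressed by testing against functions \<open>g\<close> of the past.
\<close>

locale linear_reinforcement = finite_filtration M F for M :: "'w measure" and F +
  fixes \<xi> :: "nat \<Rightarrow> 'w \<Rightarrow> real" and a v :: real
  assumes exponent: "1 / 2 < a" "a \<le> 1"
    and step_adapted: "\<And>n. 1 \<le> n \<Longrightarrow> \<xi> n \<in> borel_measurable (F n)"
    and step_bounded: "\<And>n \<omega>. \<bar>\<xi> n \<omega>\<bar> \<le> 1"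
    and drift: "\<And>n g. 1 \<le> n \<Longrightarrow> g \<in> borel_measurable (F n) \<Longrightarrow>
        expectation (\<lambda>\<omega>. g \<omega> * \<xi> (Suc n) \<omega>) = a / real n * expectation (\<lambda>\<omega>. g \<omega> * (\<Sum>i=1..n. \<xi> i \<omega>))"
    and noise: "\<And>n g. 1 \<le> n \<Longrightarrow> g \<in> borel_measurable (F n) \<Longrightarrow> (\<And>\<omega>. 0 \<le> g \<omega>) \<Longrightarrow>
        v * expectation g \<le> expectation (\<lambda>\<omega>. g \<omega> * (\<xi> (Suc n) \<omega>)\<^sup>2)"
    and noise_nonneg: "0 \<le> v"
begin

definition X :: "nat \<Rightarrow> 'w \<Rightarrow> real" where "X n \<omega> = (\<Sum>i=1..n. \<xi> i \<omega>)"

text \<open>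
  The value is chosen to make \<open>((X n)\<^sup>2 + \<kappa> * n)\<^sup>2\<close> a supermartingale after division by the
  square of \<open>growth (2 * a) n\<close>; see \<open>fourth_moment_pointwise\<close>.
\<close>

definition \<kappa> :: real where "\<kappa> = 4 / (2 * a - 1)"

lemma X_Suc: "X (Suc n) \<omega> = X n \<omega> + \<xi> (Suc n) \<omega>"
  by (simp add: X_def)

lemma X_adapted: "X n \<in> borel_measurable (F n)"
  unfolding X_def by (intro borel_measurable_sum measurable_mono[OF step_adapted]) auto

lemma X_measurable[measurable]: "X n \<in> borel_measurable M"
  by (rule measurable_top[OF X_adapted])

lemma X_drift: "1 \<le> n \<Longrightarrow> g \<in> borel_measurable (F n) \<Longrightarrow>
    expectation (\<lambda>\<omega>. g \<omega> * \<xi> (Suc n) \<omega>) = a / real n * expectation (\<lambda>\<omega>. g \<omega> * X n \<omega>)"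
  unfolding X_def by (rule drift)

lemma stage_Suc:
  assumes "1 \<le> n" "g \<in> borel_measurable (F n)"
  shows "g \<in> borel_measurable (F (Suc n))" "X n \<in> borel_measurable (F (Suc n))"
    "\<xi> (Suc n) \<in> borel_measurable (F (Suc n))" "X (Suc n) \<in> borel_measurable (F (Suc n))"
    "X n \<in> borel_measurable (F n)"
  using assms measurable_mono[of _ n "Suc n"] X_adapted step_adapted[of "Suc n"] by auto

lemma noise_le_1: "v \<le> 1"
proof -
  have "v * expectation (\<lambda>_. 1) \<le> expectation (\<lambda>\<omega>. 1 * (\<xi> (Suc 1) \<omega>)\<^sup>2)" by (rule noise) auto
  also have "\<dots> \<le> expectation (\<lambda>_. 1)"
  proof (rule integral_mono)
    have [measurable]: "\<xi> (Suc 1) \<in> borel_measurable (F (Suc 1))" by (rule step_adapted) simp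
    show "integrable M (\<lambda>\<omega>. 1 * (\<xi> (Suc 1) \<omega>)\<^sup>2)" by (rule integrable_stage[of _ "Suc 1"]) measurable
  qed (use step_bounded in \<open>auto simp: abs_square_le_1\<close>)
  finally show ?thesis by (simp add: prob_space)
qed

lemma square_step:
  assumes n: "1 \<le> n" and g: "g \<in> borel_measurable (F n)"
  shows "expectation (\<lambda>\<omega>. g \<omega> * (X (Suc n) \<omega>)\<^sup>2) =
    (1 + 2 * a / real n) * expectation (\<lambda>\<omega>. g \<omega> * (X n \<omega>)\<^sup>2) + expectation (\<lambda>\<omega>. g \<omega> * (\<xi> (Suc n) \<omega>)\<^sup>2)"
proof -
  note [measurable] = g stage_Suc[OF n g]
  have eq: "g \<omega> * (X (Suc n) \<omega>)\<^sup>2 = g \<omega> * (X n \<omega>)\<^sup>2 + 2 * ((g \<omega> * X n \<omega>) * \<xi> (Suc n) \<omega>)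
      + g \<omega> * (\<xi> (Suc n) \<omega>)\<^sup>2" for \<omega>
    by (simp add: X_Suc power2_eq_square algebra_simps)
  have i: "integrable M (\<lambda>\<omega>. g \<omega> * (X n \<omega>)\<^sup>2)" "integrable M (\<lambda>\<omega>. (g \<omega> * X n \<omega>) * \<xi> (Suc n) \<omega>)"
    "integrable M (\<lambda>\<omega>. g \<omega> * (\<xi> (Suc n) \<omega>)\<^sup>2)"
    by (rule integrable_stage[of _ "Suc n"], measurable)+
  have "expectation (\<lambda>\<omega>. (g \<omega> * X n \<omega>) * \<xi> (Suc n) \<omega>) = a / real n * expectation (\<lambda>\<omega>. (g \<omega> * X n \<omega>) * X n \<omega>)"
    by (rule X_drift[OF n]) measurable
  then have "expectation (\<lambda>\<omega>. g \<omega> * (X (Suc n) \<omega>)\<^sup>2) = expectation (\<lambda>\<omega>. g \<omega> * (X n \<omega>)\<^sup>2)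
      + 2 * (a / real n * expectation (\<lambda>\<omega>. g \<omega> * (X n \<omega>)\<^sup>2)) + expectation (\<lambda>\<omega>. g \<omega> * (\<xi> (Suc n) \<omega>)\<^sup>2)"
    unfolding eq using i by (simp add: power2_eq_square mult.assoc)
  then show ?thesis by (simp add: distrib_right)
qed

lemma noise_upper:
  assumes n: "1 \<le> n" and g: "g \<in> borel_measurable (F n)" "\<And>\<omega>. 0 \<le> g \<omega>"
  shows "expectation (\<lambda>\<omega>. g \<omega> * (\<xi> (Suc n) \<omega>)\<^sup>2) \<le> expectation g"
proof (rule integral_mono)
  note [measurable] = g stage_Suc[OF n g(1)]
  show "integrable M (\<lambda>\<omega>. g \<omega> * (\<xi> (Suc n) \<omega>)\<^sup>2)" "integrable M g"
    by (rule integrable_stage[of _ "Suc n"], measurable)+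
  show "g \<omega> * (\<xi> (Suc n) \<omega>)\<^sup>2 \<le> g \<omega>" for \<omega>
    using step_bounded[of "Suc n" \<omega>] g(2)[of \<omega>] by (simp add: abs_square_le_1 mult_left_le)
qed

text \<open>
  With \<open>c = 1 / (2 * a - 1)\<close> the linear term satisfies
  \<open>1 + c * (n + 1) = (1 + 2 * a / n) * c * n\<close>, so adding \<open>c * n\<close> to \<open>(X n)\<^sup>2\<close> absorbs the
  noise, whose conditional second moment is at most \<open>1\<close>.  This is where \<open>a > 1 / 2\<close> enters.
\<close>

lemma second_moment_upper:
  assumes "1 \<le> n"
  shows "expectation (\<lambda>\<omega>. (X n \<omega>)\<^sup>2) + real n / (2 * a - 1) \<le> growth (2 * a) n * (1 + 1 / (2 * a - 1))"
  using assms
proof (induction n rule: dec_induct)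
  case base
  have "expectation (\<lambda>\<omega>. (X 1 \<omega>)\<^sup>2) \<le> expectation (\<lambda>\<omega>. 1)"
  proof (rule integral_mono)
    note [measurable] = X_adapted
    show "integrable M (\<lambda>\<omega>. (X 1 \<omega>)\<^sup>2)" by (rule integrable_stage[of _ 1]) measurable
  qed (use step_bounded in \<open>auto simp: X_def abs_square_le_1\<close>)
  then show ?case by (simp add: prob_space growth_1)
next
  case (step n)
  let ?E = "expectation (\<lambda>\<omega>. (X n \<omega>)\<^sup>2)" let ?c = "1 / (2 * a - 1)"
  have "expectation (\<lambda>\<omega>. (X (Suc n) \<omega>)\<^sup>2) \<le> (1 + 2 * a / real n) * ?E + 1"
    using square_step[OF step(1), of "\<lambda>_. 1"] noise_upper[OF step(1), of "\<lambda>_. 1"] by (simp add: prob_space)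
  moreover have "1 + real (Suc n) * ?c = (1 + 2 * a / real n) * (real n * ?c)"
    using step(1) exponent by (simp add: field_simps)
  ultimately have "expectation (\<lambda>\<omega>. (X (Suc n) \<omega>)\<^sup>2) + real (Suc n) * ?c \<le> (1 + 2 * a / real n) * (?E + real n * ?c)"
    by (simp add: distrib_left)
  also have "\<dots> \<le> (1 + 2 * a / real n) * (growth (2 * a) n * (1 + ?c))"
    using step.IH exponent by (intro mult_left_mono) auto
  finally show ?case using growth_Suc[OF step(1), of "2 * a"] by (simp add: mult_ac)
qed

text \<open>
  The same computation in the other direction, with the noise bounded below by \<open>v\<close>: given the
  past at time \<open>n\<close>, the later square is, up to a term linear in \<open>N\<close>, at least of order
  \<open>(X n)\<^sup>2 + v * n\<close> times the growth factor, even if the position at time \<open>n\<close> happens to be \<open>0\<close>.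
\<close>

lemma second_moment_lower:
  assumes n: "1 \<le> n" "n \<le> N" and g: "g \<in> borel_measurable (F n)" "\<And>\<omega>. 0 \<le> g \<omega>"
  shows "growth (2 * a) N / growth (2 * a) n * expectation (\<lambda>\<omega>. g \<omega> * ((X n \<omega>)\<^sup>2 + v / (2 * a - 1) * real n))
     \<le> expectation (\<lambda>\<omega>. g \<omega> * ((X N \<omega>)\<^sup>2 + v / (2 * a - 1) * real N))"
proof -
  define c where "c = v / (2 * a - 1)"
  show ?thesis unfolding c_def[symmetric]
  using n(2)
proof (induction N rule: dec_induct)
  case base then show ?case using growth_pos[of "2 * a" n] exponent by simp
next
  case (step m)
  have m: "1 \<le> m" using n step by simp
  have gm: "g \<in> borel_measurable (F m)" using g step measurable_mono by blast
  have ex: "expectation (\<lambda>\<omega>. g \<omega> * ((X k \<omega>)\<^sup>2 + c * real k)) =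
     expectation (\<lambda>\<omega>. g \<omega> * (X k \<omega>)\<^sup>2) + c * real k * expectation g" if "k \<in> {m, Suc m}" for k
  proof -
    have [measurable]: "X k \<in> borel_measurable (F (Suc m))" "g \<in> borel_measurable (F (Suc m))"
      using that stage_Suc[OF m gm] by auto
    have "integrable M (\<lambda>\<omega>. g \<omega> * (X k \<omega>)\<^sup>2)" "integrable M g"
      by (rule integrable_stage[of _ "Suc m"], measurable)+
    then show ?thesis by (simp add: distrib_left mult_ac)
  qed
  have "growth (2 * a) (Suc m) / growth (2 * a) n * expectation (\<lambda>\<omega>. g \<omega> * ((X n \<omega>)\<^sup>2 + c * real n))
    \<le> (1 + 2 * a / real m) * expectation (\<lambda>\<omega>. g \<omega> * ((X m \<omega>)\<^sup>2 + c * real m))"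
    using mult_left_mono[OF step.IH, of "1 + 2 * a / real m"] exponent growth_Suc[OF m, of "2 * a"]
    by (simp add: mult_ac)
  also have "\<dots> = (1 + 2 * a / real m) * expectation (\<lambda>\<omega>. g \<omega> * (X m \<omega>)\<^sup>2) + (v + c * real (Suc m)) * expectation g"
  proof -
    have "(1 + 2 * a / real m) * (c * real m) = v + c * real (Suc m)"
      using m exponent by (simp add: c_def field_simps)
    then show ?thesis
      by (subst ex) (auto simp only: insertI1 distrib_left mult.assoc[symmetric])
  qed
  also have "\<dots> \<le> expectation (\<lambda>\<omega>. g \<omega> * ((X (Suc m) \<omega>)\<^sup>2 + c * real (Suc m)))"
    using square_step[OF m gm] noise[OF m gm g(2)] by (subst ex) (auto simp: distrib_right)
  finally show ?case .
qed
qed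

lemma kappa_ge: "4 \<le> \<kappa>" "(2 * a - 1) * \<kappa> = 4"
  using exponent by (auto simp: \<kappa>_def field_simps)

text \<open>
  One step of the recursion for \<open>((X n)\<^sup>2 + \<kappa> * n)\<^sup>2\<close>, for a position \<open>x\<close> and a step \<open>z\<close>.  The
  right-hand side is written as the desired bound plus a multiple of \<open>z\<close> minus a multiple of
  \<open>a * x / n\<close> with the same coefficient, so that the last two terms cancel in the mean.
\<close>

lemma fourth_moment_pointwise:
  fixes x :: real
  assumes n: "1 \<le> n" and w: "w = x\<^sup>2 + \<kappa> * real n" and z: "\<bar>z\<bar> \<le> 1"
  shows "((x + z)\<^sup>2 + \<kappa> * real (Suc n))\<^sup>2
    \<le> (1 + 2 * a / real n)\<^sup>2 * w\<^sup>2 + 4 * (w + \<kappa>) * x * z - 4 * a / real n * ((w + \<kappa>) * x * x)"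
proof -
  define s where "s = w + \<kappa>"
  define r where "r = a / real n"
  have s0: "0 \<le> s" "0 \<le> w" using kappa_ge by (auto simp: s_def w)
  have rn: "r * real n = a" using n by (simp add: r_def)
  have r0: "0 \<le> r" using exponent by (simp add: r_def)
  have z2: "z\<^sup>2 \<le> 1" using z by (simp add: abs_square_le_1)
  have sq: "(x + z)\<^sup>2 + \<kappa> * real (Suc n) = s + 2 * x * z + z\<^sup>2"
    by (simp add: s_def w power2_eq_square algebra_simps)
  have "((x + z)\<^sup>2 + \<kappa> * real (Suc n))\<^sup>2
      = s\<^sup>2 + 4 * s * x * z + 2 * s * z\<^sup>2 + 4 * x\<^sup>2 * z\<^sup>2 + 4 * x * z * z\<^sup>2 + z\<^sup>2 * z\<^sup>2"
    unfolding sq by (simp add: power2_eq_square algebra_simps)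
  \<comment> \<open>The term linear in \<open>z\<close> is kept exactly; all others are bounded by \<open>z\<^sup>2 \<le> 1\<close> and \<open>2 * x * z \<le> x\<^sup>2 + 1\<close>.\<close>
  also have "\<dots> \<le> s\<^sup>2 + 4 * s * x * z + 2 * s + 4 * x\<^sup>2 + (2 * x\<^sup>2 + 2) + 1"
  proof -
    have "s * z\<^sup>2 \<le> s" "x\<^sup>2 * z\<^sup>2 \<le> x\<^sup>2"
      using z2 s0 by (auto intro: mult_left_le)
    moreover have "z\<^sup>2 * z\<^sup>2 \<le> 1" by (rule mult_le_one[OF z2 _ z2]) simp
    moreover have "4 * x * z * z\<^sup>2 \<le> 2 * x\<^sup>2 + 2"
    proof -
      have "2 * (x * z) \<le> x\<^sup>2 + 1"
      proof -
        have "0 \<le> (x - z)\<^sup>2" by simp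
        then show ?thesis using z2 by (simp add: power2_eq_square algebra_simps)
      qed
      then have "2 * (x * z) * z\<^sup>2 \<le> (x\<^sup>2 + 1) * z\<^sup>2" by (intro mult_right_mono) auto
      also have "\<dots> \<le> x\<^sup>2 + 1" using z2 by (intro mult_left_le) auto
      finally show ?thesis by simp
    qed
    ultimately show ?thesis by linarith
  qed
  \<comment> \<open>The surplus \<open>(4 * a - 2) * \<kappa> * w = 8 * w\<close> pays for \<open>2 * s + 6 * x\<^sup>2 + 3\<close>, and \<open>4 * r\<^sup>2 * w\<^sup>2\<close> for the rest.\<close>
  also have "\<dots> \<le> (1 + 2 * r)\<^sup>2 * w\<^sup>2 + 4 * s * x * z - 4 * r * (s * x * x)"
  proof -
    have "(4 * a - 2) * \<kappa> * w = 2 * w * ((2 * a - 1) * \<kappa>)" by (simp add: algebra_simps)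
    then have k4: "(4 * a - 2) * \<kappa> * w = 8 * w" unfolding kappa_ge(2) by simp
    have rw: "r * w * w = r * w * x\<^sup>2 + a * \<kappa> * w"
    proof -
      have "r * w * w = r * w * x\<^sup>2 + (r * real n) * \<kappa> * w" by (simp add: w algebra_simps)
      then show ?thesis unfolding rn .
    qed
    have "4 * r\<^sup>2 * w\<^sup>2 \<ge> \<kappa>\<^sup>2 + 4 * r * \<kappa> * x\<^sup>2"
    proof -
      have "r * w = r * x\<^sup>2 + (r * real n) * \<kappa>" by (simp add: w algebra_simps)
      then have "r * w = r * x\<^sup>2 + a * \<kappa>" unfolding rn .
      then have "4 * r\<^sup>2 * w\<^sup>2 = 4 * (r * x\<^sup>2 + a * \<kappa>)\<^sup>2" by (simp add: power_mult_distrib[symmetric])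
      also have "\<dots> = 4 * (r * x\<^sup>2)\<^sup>2 + 4 * (2 * a) * r * \<kappa> * x\<^sup>2 + (2 * a)\<^sup>2 * \<kappa>\<^sup>2"
        by (simp add: power2_eq_square algebra_simps)
      also have "\<dots> \<ge> 0 + 4 * 1 * r * \<kappa> * x\<^sup>2 + 1 * \<kappa>\<^sup>2"
        using exponent kappa_ge r0 one_le_power[of "2 * a" 2]
        by (intro add_mono mult_right_mono mult_left_mono) auto
      finally show ?thesis by simp
    qed
    moreover have "2 * \<kappa> + 3 \<le> 6 * \<kappa> * real n"
    proof -
      have "6 * \<kappa> * 1 \<le> 6 * \<kappa> * real n" using kappa_ge n by (intro mult_left_mono) auto
      then show ?thesis using kappa_ge by linarith
    qed
    moreover have "(1 + 2 * r)\<^sup>2 * w\<^sup>2 = w\<^sup>2 + 4 * (r * w * w) + 4 * r\<^sup>2 * w\<^sup>2"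
      by (simp add: power2_eq_square algebra_simps)
    moreover have "s\<^sup>2 = w\<^sup>2 + 2 * \<kappa> * w + \<kappa>\<^sup>2" by (simp add: s_def power2_eq_square algebra_simps)
    moreover have "4 * r * (s * x * x) = 4 * (r * w * x\<^sup>2) + 4 * r * \<kappa> * x\<^sup>2"
      by (simp add: s_def power2_eq_square algebra_simps)
    moreover have "4 * (a * \<kappa> * w) = 2 * \<kappa> * w + 8 * w" using k4 by (simp add: algebra_simps)
    moreover have "2 * s = 2 * w + 2 * \<kappa>" "6 * w = 6 * x\<^sup>2 + 6 * \<kappa> * real n" by (simp_all add: s_def w)
    ultimately show ?thesis using rw by linarith
  qed
  finally show ?thesis by (simp add: r_def s_def)
qed

text \<open>
  Together with the lower bound on second moments this says that, given the past at time \<open>n\<close>,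
  the square of the later position has a fourth moment comparable with the square of its second
  moment, uniformly in the past.  That is the input of the Paley--Zygmund argument below.
\<close>

lemma fourth_moment_upper:
  assumes n: "1 \<le> n" "n \<le> N" and g: "g \<in> borel_measurable (F n)" "\<And>\<omega>. 0 \<le> g \<omega>"
  shows "expectation (\<lambda>\<omega>. g \<omega> * ((X N \<omega>)\<^sup>2 + \<kappa> * real N)\<^sup>2)
    \<le> (growth (2 * a) N / growth (2 * a) n)\<^sup>2 * expectation (\<lambda>\<omega>. g \<omega> * ((X n \<omega>)\<^sup>2 + \<kappa> * real n)\<^sup>2)"
  using n(2)
proof (induction N rule: dec_induct)
  case base then show ?case using growth_pos[of "2 * a" n] exponent by simp
next
  case (step m)
  have m: "1 \<le> m" using n step by simp
  have gm: "g \<in> borel_measurable (F m)" using g step measurable_mono by blast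
  note [measurable] = gm stage_Suc[OF m gm]
  define w where "w \<omega> = (X m \<omega>)\<^sup>2 + \<kappa> * real m" for \<omega>
  have [measurable]: "w \<in> borel_measurable (F m)" "w \<in> borel_measurable (F (Suc m))"
    unfolding w_def by measurable
  \<comment> \<open>the coefficient of the step in the pointwise bound, up to the factor 4\<close>
  define h where "h \<omega> = g \<omega> * (w \<omega> + \<kappa>) * X m \<omega>" for \<omega>
  have [measurable]: "h \<in> borel_measurable (F m)" "h \<in> borel_measurable (F (Suc m))"
    unfolding h_def by measurable
  let ?r = "1 + 2 * a / real m"
  have i: "integrable M (\<lambda>\<omega>. g \<omega> * (w \<omega>)\<^sup>2)" "integrable M (\<lambda>\<omega>. h \<omega> * X m \<omega>)"
    "integrable M (\<lambda>\<omega>. h \<omega> * \<xi> (Suc m) \<omega>)"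
    "integrable M (\<lambda>\<omega>. g \<omega> * ((X (Suc m) \<omega>)\<^sup>2 + \<kappa> * real (Suc m))\<^sup>2)"
    by (rule integrable_stage[of _ "Suc m"], measurable)+
  have d: "expectation (\<lambda>\<omega>. h \<omega> * \<xi> (Suc m) \<omega>) = a / real m * expectation (\<lambda>\<omega>. h \<omega> * X m \<omega>)"
    by (rule X_drift[OF m]) measurable
  have "expectation (\<lambda>\<omega>. g \<omega> * ((X (Suc m) \<omega>)\<^sup>2 + \<kappa> * real (Suc m))\<^sup>2) \<le>
     expectation (\<lambda>\<omega>. ?r\<^sup>2 * (g \<omega> * (w \<omega>)\<^sup>2) + 4 * (h \<omega> * \<xi> (Suc m) \<omega>) - 4 * a / real m * (h \<omega> * X m \<omega>))"
  proof (rule integral_mono)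
    fix \<omega>
    have "g \<omega> * ((X m \<omega> + \<xi> (Suc m) \<omega>)\<^sup>2 + \<kappa> * real (Suc m))\<^sup>2 \<le>
      g \<omega> * (?r\<^sup>2 * (w \<omega>)\<^sup>2 + 4 * (w \<omega> + \<kappa>) * X m \<omega> * \<xi> (Suc m) \<omega> - 4 * a / real m * ((w \<omega> + \<kappa>) * X m \<omega> * X m \<omega>))"
      by (intro mult_left_mono fourth_moment_pointwise[OF m w_def step_bounded] g(2))
    then show "g \<omega> * ((X (Suc m) \<omega>)\<^sup>2 + \<kappa> * real (Suc m))\<^sup>2 \<le>
       ?r\<^sup>2 * (g \<omega> * (w \<omega>)\<^sup>2) + 4 * (h \<omega> * \<xi> (Suc m) \<omega>) - 4 * a / real m * (h \<omega> * X m \<omega>)"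
      unfolding X_Suc h_def by (simp add: algebra_simps)
  qed (use i in auto)
  also have "\<dots> = ?r\<^sup>2 * expectation (\<lambda>\<omega>. g \<omega> * (w \<omega>)\<^sup>2)"
    using i d by simp
  also have "\<dots> \<le> ?r\<^sup>2 * ((growth (2 * a) m / growth (2 * a) n)\<^sup>2 * expectation (\<lambda>\<omega>. g \<omega> * ((X n \<omega>)\<^sup>2 + \<kappa> * real n)\<^sup>2))"
    using step.IH unfolding w_def by (intro mult_left_mono) auto
  finally show ?case using growth_Suc[OF m, of "2 * a"] by (simp add: power_mult_distrib power_divide mult_ac)
qed

section \<open>The limit of a linearly reinforced walk\<close>

text \<open>
  Dividing the walk by \<open>growth a n\<close> compensates the drift exactly and gives a martingale bounded
  in \<open>L\<^sup>2\<close>; passing from \<open>growth a n\<close> to \<open>n powr a\<close> changes the limit by a positive constant factor.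
\<close>

lemma rescaled_convergent: "AE \<omega> in M. convergent (\<lambda>n. X n \<omega> / real n powr a)"
proof -
  interpret Z: finite_martingale M F "\<lambda>n \<omega>. X n \<omega> / growth a n"
  proof
    fix n :: nat assume n: "1 \<le> n"
    show "(\<lambda>\<omega>. X n \<omega> / growth a n) \<in> borel_measurable (F n)"
      by (intro borel_measurable_divide X_adapted borel_measurable_const)
    fix g :: "'w \<Rightarrow> real" assume g: "g \<in> borel_measurable (F n)"
    note [measurable] = stage_Suc[OF n g]
    have pos: "0 < growth a n" "0 < growth a (Suc n)" using exponent by (auto intro: growth_pos)
    have "g \<omega> * (X (Suc n) \<omega> / growth a (Suc n) - X n \<omega> / growth a n)
        = (g \<omega> * \<xi> (Suc n) \<omega> - a / real n * (g \<omega> * X n \<omega>)) / growth a (Suc n)" for \<omega>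
    proof -
      have "X n \<omega> / growth a n = X n \<omega> * (1 + a / real n) / growth a (Suc n)"
        using pos n exponent by (simp add: growth_Suc add_nonneg_eq_0_iff)
      then show ?thesis by (simp add: X_Suc diff_divide_distrib add_divide_distrib algebra_simps)
    qed
    moreover have "integrable M (\<lambda>\<omega>. g \<omega> * \<xi> (Suc n) \<omega>)" "integrable M (\<lambda>\<omega>. g \<omega> * X n \<omega>)"
      by (rule integrable_stage[of _ "Suc n"], measurable)+
    ultimately show "expectation (\<lambda>\<omega>. g \<omega> * (X (Suc n) \<omega> / growth a (Suc n) - X n \<omega> / growth a n)) = 0"
      using X_drift[OF n g] by simp
  qed
  have "AE \<omega> in M. convergent (\<lambda>n. X n \<omega> / growth a n)"
  proof (rule Z.L2_bounded_convergent)
    fix n :: nat assume n: "1 \<le> n"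
    have pos: "0 < growth a n" using exponent by (auto intro: growth_pos)
    have "expectation (\<lambda>\<omega>. (X n \<omega>)\<^sup>2) \<le> growth (2 * a) n * (1 + 1 / (2 * a - 1))"
    proof -
      have "0 \<le> real n / (2 * a - 1)" using exponent by simp
      then show ?thesis using second_moment_upper[OF n] by linarith
    qed
    also have "\<dots> \<le> (growth a n)\<^sup>2 * (1 + 1 / (2 * a - 1))"
      using exponent by (intro mult_right_mono growth_double_le) auto
    finally have "expectation (\<lambda>\<omega>. (X n \<omega>)\<^sup>2) \<le> (growth a n)\<^sup>2 * (1 + 1 / (2 * a - 1))" .
    then show "expectation (\<lambda>\<omega>. (X n \<omega> / growth a n)\<^sup>2) \<le> 1 + 1 / (2 * a - 1)"
      using pos by (simp add: power_divide divide_le_eq mult_ac)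
  qed
  then show ?thesis
  proof eventually_elim
    case (elim \<omega>)
    then obtain z where "(\<lambda>n. X n \<omega> / growth a n) \<longlonglongrightarrow> z" by (auto simp: convergent_def)
    moreover obtain L where "(\<lambda>n. growth a n / real n powr a) \<longlonglongrightarrow> L"
      using growth_asymptotics[of a] exponent by auto
    ultimately have "(\<lambda>n. X n \<omega> / growth a n * (growth a n / real n powr a)) \<longlonglongrightarrow> z * L"
      by (rule tendsto_mult)
    moreover have "growth a n \<noteq> 0" for n using growth_pos[of a n] exponent by simp
    ultimately show ?case by (auto simp: convergent_def)
  qed
qed

definition Y :: "'w \<Rightarrow> real" where "Y \<omega> = lim (\<lambda>n. X n \<omega> / real n powr a)"

lemma Y_measurable[measurable]: "Y \<in> borel_measurable M"
  unfolding Y_def by measurable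

lemma rescaled_tendsto: "AE \<omega> in M. (\<lambda>n. X n \<omega> / real n powr a) \<longlonglongrightarrow> Y \<omega>"
  using rescaled_convergent by eventually_elim (simp add: Y_def convergent_LIMSEQ_iff)

text \<open>
  The correction terms linear in the horizon, which made the moment recursions exact, are negligible
  in the limit because \<open>2 * a > 1\<close>.
\<close>

lemma linear_over_growth: "(\<lambda>N. real N / growth (2 * a) N) \<longlonglongrightarrow> 0"
proof -
  obtain L where L: "L > 0" "(\<lambda>n. growth (2 * a) n / real n powr (2 * a)) \<longlonglongrightarrow> L"
    using growth_asymptotics[of "2 * a"] exponent by auto
  have "(\<lambda>n. (real n / real n powr (2 * a)) / (growth (2 * a) n / real n powr (2 * a))) \<longlonglongrightarrow> 0 / L"
  proof (rule tendsto_divide[OF _ L(2)])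
    show "(\<lambda>n. real n / real n powr (2 * a)) \<longlonglongrightarrow> 0" using exponent by real_asymp
  qed (use L in simp)
  then have "(\<lambda>n. (real n / real n powr (2 * a)) / (growth (2 * a) n / real n powr (2 * a))) \<longlonglongrightarrow> 0"
    by simp
  then show ?thesis
    by (rule Lim_transform_eventually) (auto intro!: eventually_mono[OF eventually_gt_at_top[of 0]])
qed

text \<open>
  Whatever happened up to time \<open>n\<close>, the limit is nonzero with conditional probability at least
  \<open>v\<^sup>2 / 16\<close>.  Normalise the later square by its natural size given the past,
  \<open>y N = (X N)\<^sup>2 / (growth (2 * a) N / growth (2 * a) n * w)\<close> with \<open>w = (X n)\<^sup>2 + \<kappa> * n\<close>.  Its conditional
  mean is at least \<open>l = v / 4\<close> up to a vanishing error and its conditional second moment is at most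
  \<open>1\<close>.  The parabola \<open>2 * l * t - l\<^sup>2 * t\<^sup>2\<close> is at most \<open>1\<close> and vanishes at \<open>0\<close>; its mean at \<open>y N\<close> is
  therefore at least \<open>2 * l * l - l\<^sup>2 = l\<^sup>2\<close> in the limit, while its positive part \<open>\<phi>\<close> is bounded and
  continuous, so that \<open>N\<close> can be sent to infinity.  The limit of \<open>y N\<close> is a positive multiple of
  \<open>(Y \<omega>)\<^sup>2\<close>, whence \<open>\<phi>\<close> of it is at most the indicator of \<open>Y \<omega> \<noteq> 0\<close>.
\<close>

lemma escape_from_stage:
  assumes n: "1 \<le> n" and g: "g \<in> borel_measurable (F n)" "\<And>\<omega>. 0 \<le> g \<omega>"
  shows "v\<^sup>2 / 16 * expectation g \<le> expectation (\<lambda>\<omega>. g \<omega> * indicator {\<omega>\<in>space M. Y \<omega> \<noteq> 0} \<omega>)"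
proof -
  define b where "b = growth (2 * a)"
  have b_pos: "0 < b N" for N unfolding b_def using exponent by (intro growth_pos) auto
  define w where "w \<omega> = (X n \<omega>)\<^sup>2 + \<kappa> * real n" for \<omega>
  have w_pos: "0 < w \<omega>" for \<omega>
    unfolding w_def using kappa_ge n by (intro add_nonneg_pos) (auto intro: mult_pos_pos)
  define y where "y N \<omega> = (X N \<omega>)\<^sup>2 * b n / (b N * w \<omega>)" for N \<omega>
  define l where "l = v / 4"
  define \<phi> where "\<phi> t = max 0 (2 * l * t - l\<^sup>2 * t\<^sup>2)" for t :: real
  have phi_le_1: "\<phi> t \<le> 1" for t
  proof -
    have "0 \<le> (1 - l * t)\<^sup>2" by simp
    then show ?thesis by (simp add: \<phi>_def power2_eq_square algebra_simps)
  qed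
  have phi_bound: "norm (g \<omega> * \<phi> t) \<le> g \<omega>" for \<omega> t
  proof -
    have "0 \<le> \<phi> t" by (simp add: \<phi>_def)
    then show ?thesis using phi_le_1[of t] g(2)[of \<omega>] by (simp add: mult_left_le)
  qed
  have phi_0: "\<phi> 0 = 0" by (simp add: \<phi>_def)
  note [measurable] = g(1) X_adapted
  have w_F[measurable]: "w \<in> borel_measurable (F n)" unfolding w_def by measurable
  define gw where "gw \<omega> = g \<omega> / w \<omega>" for \<omega>
  have gw_F[measurable]: "gw \<in> borel_measurable (F n)" unfolding gw_def by measurable
  have gw_nonneg: "0 \<le> gw \<omega>" for \<omega> using g(2) w_pos[of \<omega>] by (simp add: gw_def)
  have gw2_F[measurable]: "(\<lambda>\<omega>. g \<omega> / (w \<omega>)\<^sup>2) \<in> borel_measurable (F n)" by measurable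
  let ?c = "v / (2 * a - 1)"
  have c_kappa: "?c = l * \<kappa>" by (simp add: l_def \<kappa>_def)
  have g_M[measurable]: "g \<in> borel_measurable M" "w \<in> borel_measurable M"
    using measurable_top[OF g(1)] measurable_top[OF w_F] by auto
  have ig: "integrable M g" by (rule integrable_stage[OF g(1)])
  have stage: "integrable M (\<lambda>\<omega>. g \<omega> * y N \<omega>)" "integrable M (\<lambda>\<omega>. g \<omega> * (y N \<omega>)\<^sup>2)"
    "integrable M (\<lambda>\<omega>. gw \<omega> * (X N \<omega>)\<^sup>2)" "integrable M gw"
    "integrable M (\<lambda>\<omega>. g \<omega> / (w \<omega>)\<^sup>2 * ((X N \<omega>)\<^sup>2 + \<kappa> * real N)\<^sup>2)" if "n \<le> N" for N
  proof -
    note [measurable] = measurable_mono[OF g(1) that] measurable_mono[OF w_F that]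
      measurable_mono[OF gw_F that]
    show "integrable M (\<lambda>\<omega>. g \<omega> * y N \<omega>)" "integrable M (\<lambda>\<omega>. g \<omega> * (y N \<omega>)\<^sup>2)"
      "integrable M (\<lambda>\<omega>. gw \<omega> * (X N \<omega>)\<^sup>2)" "integrable M gw"
      "integrable M (\<lambda>\<omega>. g \<omega> / (w \<omega>)\<^sup>2 * ((X N \<omega>)\<^sup>2 + \<kappa> * real N)\<^sup>2)"
      unfolding y_def by (rule integrable_stage[of _ N], measurable)+
  qed
  have first: "l * expectation g - ?c * b n * expectation gw * (real N / b N)
      \<le> expectation (\<lambda>\<omega>. g \<omega> * y N \<omega>)" if N: "n \<le> N" for N
  proof -
    have "l * expectation g \<le> expectation (\<lambda>\<omega>. gw \<omega> * ((X n \<omega>)\<^sup>2 + ?c * real n))"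
    proof -
      have "expectation (\<lambda>\<omega>. l * g \<omega>) \<le> expectation (\<lambda>\<omega>. gw \<omega> * ((X n \<omega>)\<^sup>2 + ?c * real n))"
      proof (rule integral_mono)
        show "integrable M (\<lambda>\<omega>. gw \<omega> * ((X n \<omega>)\<^sup>2 + ?c * real n))"
          by (rule integrable_stage[of _ n]) measurable
        fix \<omega>
        have "l * w \<omega> \<le> (X n \<omega>)\<^sup>2 + ?c * real n"
        proof -
          have "l * (X n \<omega>)\<^sup>2 \<le> (X n \<omega>)\<^sup>2"
            using noise_le_1 noise_nonneg by (intro mult_left_le_one_le) (auto simp: l_def)
          then show ?thesis unfolding w_def c_kappa by (simp add: distrib_left mult.assoc)
        qed
        then have "gw \<omega> * (l * w \<omega>) \<le> gw \<omega> * ((X n \<omega>)\<^sup>2 + ?c * real n)"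
          by (intro mult_left_mono gw_nonneg)
        then show "l * g \<omega> \<le> gw \<omega> * ((X n \<omega>)\<^sup>2 + ?c * real n)"
          using w_pos[of \<omega>] by (simp add: gw_def mult_ac)
      qed (use ig in auto)
      then show ?thesis by simp
    qed
    then have "b N / b n * (l * expectation g) \<le> b N / b n * expectation (\<lambda>\<omega>. gw \<omega> * ((X n \<omega>)\<^sup>2 + ?c * real n))"
      using b_pos[of n] b_pos[of N] by (intro mult_left_mono) auto
    also have "\<dots> \<le> expectation (\<lambda>\<omega>. gw \<omega> * ((X N \<omega>)\<^sup>2 + ?c * real N))"
      unfolding b_def by (rule second_moment_lower[OF n N gw_F gw_nonneg])
    also have "\<dots> = expectation (\<lambda>\<omega>. gw \<omega> * (X N \<omega>)\<^sup>2) + ?c * real N * expectation gw"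
      using stage(3,4)[OF N] by (simp add: distrib_left mult_ac)
    finally have "b n / b N * (b N / b n * (l * expectation g))
       \<le> b n / b N * (expectation (\<lambda>\<omega>. gw \<omega> * (X N \<omega>)\<^sup>2) + ?c * real N * expectation gw)"
      using b_pos[of n] b_pos[of N] by (intro mult_left_mono) auto
    moreover have "b n / b N * (b N / b n * (l * expectation g)) = l * expectation g"
      using b_pos[of n] b_pos[of N] by simp
    moreover have "b n / b N * expectation (\<lambda>\<omega>. gw \<omega> * (X N \<omega>)\<^sup>2) = expectation (\<lambda>\<omega>. g \<omega> * y N \<omega>)"
      unfolding y_def gw_def integral_mult_right_zero[symmetric] by (simp add: mult_ac)
    ultimately show ?thesis by (simp add: distrib_left mult_ac)
  qed
  have second: "expectation (\<lambda>\<omega>. g \<omega> * (y N \<omega>)\<^sup>2) \<le> expectation g" if N: "n \<le> N" for N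
  proof -
    have "expectation (\<lambda>\<omega>. g \<omega> * (y N \<omega>)\<^sup>2)
      \<le> expectation (\<lambda>\<omega>. (b n / b N)\<^sup>2 * (g \<omega> / (w \<omega>)\<^sup>2 * ((X N \<omega>)\<^sup>2 + \<kappa> * real N)\<^sup>2))"
    proof (rule integral_mono)
      fix \<omega>
      have "((X N \<omega>)\<^sup>2)\<^sup>2 \<le> ((X N \<omega>)\<^sup>2 + \<kappa> * real N)\<^sup>2" using kappa_ge by (intro power_mono) auto
      then have "(b n / b N)\<^sup>2 * (g \<omega> / (w \<omega>)\<^sup>2) * ((X N \<omega>)\<^sup>2)\<^sup>2
        \<le> (b n / b N)\<^sup>2 * (g \<omega> / (w \<omega>)\<^sup>2) * ((X N \<omega>)\<^sup>2 + \<kappa> * real N)\<^sup>2"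
        using g(2) by (intro mult_left_mono) auto
      moreover have "g \<omega> * (y N \<omega>)\<^sup>2 = (b n / b N)\<^sup>2 * (g \<omega> / (w \<omega>)\<^sup>2) * ((X N \<omega>)\<^sup>2)\<^sup>2"
        unfolding y_def by (simp add: power_divide power_mult_distrib)
      ultimately show "g \<omega> * (y N \<omega>)\<^sup>2 \<le> (b n / b N)\<^sup>2 * (g \<omega> / (w \<omega>)\<^sup>2 * ((X N \<omega>)\<^sup>2 + \<kappa> * real N)\<^sup>2)"
        by (simp only: mult.assoc)
    qed (intro integrable_mult_right stage(2,5)[OF N])+
    also have "\<dots> = (b n / b N)\<^sup>2 * expectation (\<lambda>\<omega>. g \<omega> / (w \<omega>)\<^sup>2 * ((X N \<omega>)\<^sup>2 + \<kappa> * real N)\<^sup>2)"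
      by (rule integral_mult_right_zero)
    also have "\<dots> \<le> (b n / b N)\<^sup>2 * ((b N / b n)\<^sup>2 * expectation (\<lambda>\<omega>. g \<omega> / (w \<omega>)\<^sup>2 * (w \<omega>)\<^sup>2))"
      unfolding w_def b_def
      by (intro mult_left_mono fourth_moment_upper[OF n N gw2_F[unfolded w_def]]) (auto simp: g(2))
    also have "\<dots> = expectation g"
    proof -
      have "g \<omega> / (w \<omega>)\<^sup>2 * (w \<omega>)\<^sup>2 = g \<omega>" for \<omega> using w_pos[of \<omega>] by simp
      then show ?thesis using b_pos[of n] b_pos[of N] by (simp add: power_divide)
    qed
    finally show ?thesis .
  qed
  have i\<phi>: "integrable M (\<lambda>\<omega>. g \<omega> * \<phi> (y N \<omega>))" if N: "n \<le> N" for N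
  proof (rule Bochner_Integration.integrable_bound[OF ig])
    show "(\<lambda>\<omega>. g \<omega> * \<phi> (y N \<omega>)) \<in> borel_measurable M" unfolding \<phi>_def y_def by measurable
    show "AE \<omega> in M. norm (g \<omega> * \<phi> (y N \<omega>)) \<le> norm (g \<omega>)"
      by (intro AE_I2 order_trans[OF phi_bound]) simp
  qed
  have lower: "2 * l * (l * expectation g - ?c * b n * expectation gw * (real N / b N)) - l\<^sup>2 * expectation g
      \<le> expectation (\<lambda>\<omega>. g \<omega> * \<phi> (y N \<omega>))" if N: "n \<le> N" for N
  proof -
    have "2 * l * (l * expectation g - ?c * b n * expectation gw * (real N / b N)) - l\<^sup>2 * expectation g
      \<le> 2 * l * expectation (\<lambda>\<omega>. g \<omega> * y N \<omega>) - l\<^sup>2 * expectation (\<lambda>\<omega>. g \<omega> * (y N \<omega>)\<^sup>2)"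
      using first[OF N] second[OF N] noise_nonneg by (intro diff_mono mult_left_mono) (auto simp: l_def)
    also have "\<dots> = expectation (\<lambda>\<omega>. 2 * l * (g \<omega> * y N \<omega>) - l\<^sup>2 * (g \<omega> * (y N \<omega>)\<^sup>2))"
      using stage[OF N] by simp
    also have "\<dots> \<le> expectation (\<lambda>\<omega>. g \<omega> * \<phi> (y N \<omega>))"
    proof (rule integral_mono)
      fix \<omega>
      have "g \<omega> * (2 * l * y N \<omega> - l\<^sup>2 * (y N \<omega>)\<^sup>2) \<le> g \<omega> * \<phi> (y N \<omega>)"
        using g(2) by (intro mult_left_mono) (auto simp: \<phi>_def)
      then show "2 * l * (g \<omega> * y N \<omega>) - l\<^sup>2 * (g \<omega> * (y N \<omega>)\<^sup>2) \<le> g \<omega> * \<phi> (y N \<omega>)"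
        by (simp add: algebra_simps)
    qed (use stage[OF N] i\<phi>[OF N] in auto)
    finally show ?thesis .
  qed
  obtain L where L: "L > 0" "(\<lambda>n. b n / real n powr (2 * a)) \<longlonglongrightarrow> L"
    using growth_asymptotics[of "2 * a"] exponent by (auto simp: b_def)
  have y_lim: "AE \<omega> in M. (\<lambda>N. y N \<omega>) \<longlonglongrightarrow> (Y \<omega>)\<^sup>2 / L * b n / w \<omega>"
    using rescaled_tendsto
  proof eventually_elim
    case (elim \<omega>)
    have "(\<lambda>N. (X N \<omega> / real N powr a)\<^sup>2 / (b N / real N powr (2 * a)) * b n / w \<omega>)
      \<longlonglongrightarrow> (Y \<omega>)\<^sup>2 / L * b n / w \<omega>"
      using L w_pos[of \<omega>] by (intro tendsto_intros elim) auto
    then show ?case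
    proof (rule Lim_transform_eventually)
      show "eventually (\<lambda>N. (X N \<omega> / real N powr a)\<^sup>2 / (b N / real N powr (2 * a)) * b n / w \<omega> = y N \<omega>) sequentially"
        using eventually_gt_at_top[of 0]
      proof eventually_elim
        case (elim N)
        have "(real N powr a)\<^sup>2 = real N powr (2 * a)" "real N powr (2 * a) > 0"
          using elim by (simp_all add: powr_power mult.commute)
        then show ?case unfolding y_def by (simp add: power_divide)
      qed
    qed
  qed
  have "(\<lambda>N. expectation (\<lambda>\<omega>. g \<omega> * \<phi> (y N \<omega>))) \<longlonglongrightarrow> expectation (\<lambda>\<omega>. g \<omega> * \<phi> ((Y \<omega>)\<^sup>2 / L * b n / w \<omega>))"
  proof (rule integral_dominated_convergence[OF _ _ ig])
    show "AE \<omega> in M. (\<lambda>N. g \<omega> * \<phi> (y N \<omega>)) \<longlonglongrightarrow> g \<omega> * \<phi> ((Y \<omega>)\<^sup>2 / L * b n / w \<omega>)"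
      using y_lim by eventually_elim (unfold \<phi>_def, intro tendsto_intros)
    show "AE \<omega> in M. norm (g \<omega> * \<phi> (y N \<omega>)) \<le> g \<omega>" for N
      by (intro AE_I2 phi_bound)
  qed (unfold \<phi>_def y_def, measurable)
  moreover have "(\<lambda>N. 2 * l * (l * expectation g - ?c * b n * expectation gw * (real N / b N)) - l\<^sup>2 * expectation g)
    \<longlonglongrightarrow> 2 * l * (l * expectation g - ?c * b n * expectation gw * 0) - l\<^sup>2 * expectation g"
    using linear_over_growth unfolding b_def by (intro tendsto_intros)
  ultimately have "2 * l * (l * expectation g - ?c * b n * expectation gw * 0) - l\<^sup>2 * expectation g
      \<le> expectation (\<lambda>\<omega>. g \<omega> * \<phi> ((Y \<omega>)\<^sup>2 / L * b n / w \<omega>))"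
    using lower by (intro LIMSEQ_le) auto
  also have "\<dots> \<le> expectation (\<lambda>\<omega>. g \<omega> * indicator {\<omega>\<in>space M. Y \<omega> \<noteq> 0} \<omega>)"
  proof (rule integral_mono)
    show "integrable M (\<lambda>\<omega>. g \<omega> * indicator {\<omega>\<in>space M. Y \<omega> \<noteq> 0} \<omega>)"
      using ig by (intro integrable_real_mult_indicator) auto
    show "integrable M (\<lambda>\<omega>. g \<omega> * \<phi> ((Y \<omega>)\<^sup>2 / L * b n / w \<omega>))"
    proof (rule Bochner_Integration.integrable_bound[OF ig])
      show "(\<lambda>\<omega>. g \<omega> * \<phi> ((Y \<omega>)\<^sup>2 / L * b n / w \<omega>)) \<in> borel_measurable M" unfolding \<phi>_def by measurable
      show "AE \<omega> in M. norm (g \<omega> * \<phi> ((Y \<omega>)\<^sup>2 / L * b n / w \<omega>)) \<le> norm (g \<omega>)"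
        by (intro AE_I2 order_trans[OF phi_bound]) simp
    qed
    show "g \<omega> * \<phi> ((Y \<omega>)\<^sup>2 / L * b n / w \<omega>) \<le> g \<omega> * indicator {\<omega>\<in>space M. Y \<omega> \<noteq> 0} \<omega>" if "\<omega> \<in> space M" for \<omega>
      using that phi_le_1 phi_0 g(2) by (intro mult_left_mono) (auto simp: indicator_def)
  qed
  finally show ?thesis by (simp add: l_def power2_eq_square)
qed

text \<open>
  Testing the previous bound with \<open>g = 1 / (1 + m * (X n / n powr a)\<^sup>2)\<close> and letting \<open>n\<close> tend to
  infinity replaces \<open>X n / n powr a\<close> by \<open>Y\<close> on both sides.  As \<open>m\<close> tends to infinity these test functions
  concentrate on the event \<open>Y \<omega> = 0\<close>, on which the right-hand side vanishes.  This plays the role of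
  Levy's zero-one law.
\<close>

theorem limit_nonzero:
  assumes v: "0 < v"
  shows "AE \<omega> in M. Y \<omega> \<noteq> 0"
proof -
  define A where "A = {\<omega>\<in>space M. Y \<omega> \<noteq> 0}"
  have A[measurable]: "A \<in> sets M" unfolding A_def by measurable
  have bound: "norm (1 / (1 + real m * t\<^sup>2)) \<le> 1" for m t
  proof -
    have "0 \<le> real m * t\<^sup>2" by simp
    then show ?thesis by (simp add: divide_le_eq_1 add_pos_nonneg)
  qed
  have key: "v\<^sup>2 / 16 * expectation (\<lambda>\<omega>. 1 / (1 + real m * (Y \<omega>)\<^sup>2))
    \<le> expectation (\<lambda>\<omega>. 1 / (1 + real m * (Y \<omega>)\<^sup>2) * indicator A \<omega>)" for m
  proof (rule LIMSEQ_le)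
    let ?g = "\<lambda>n \<omega>. 1 / (1 + real m * (X n \<omega> / real n powr a)\<^sup>2)"
    have ne: "1 + real m * t\<^sup>2 \<noteq> 0" for t
    proof -
      have "0 \<le> real m * t\<^sup>2" by simp
      then show ?thesis by linarith
    qed
    show "\<exists>N. \<forall>n\<ge>N. v\<^sup>2 / 16 * expectation (?g n) \<le> expectation (\<lambda>\<omega>. ?g n \<omega> * indicator A \<omega>)"
      unfolding A_def
    proof (intro exI[of _ 1] allI impI escape_from_stage)
      fix n :: nat
      note [measurable] = X_adapted
      show "?g n \<in> borel_measurable (F n)" by measurable
    qed auto
    show "(\<lambda>n. v\<^sup>2 / 16 * expectation (?g n)) \<longlonglongrightarrow> v\<^sup>2 / 16 * expectation (\<lambda>\<omega>. 1 / (1 + real m * (Y \<omega>)\<^sup>2))"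
    proof (intro tendsto_mult tendsto_const integral_dominated_convergence[where w="\<lambda>_. 1"])
      show "AE \<omega> in M. (\<lambda>n. ?g n \<omega>) \<longlonglongrightarrow> 1 / (1 + real m * (Y \<omega>)\<^sup>2)"
        using rescaled_tendsto by eventually_elim (intro tendsto_intros ne)
    qed (auto intro!: AE_I2 bound[simplified])
    show "(\<lambda>n. expectation (\<lambda>\<omega>. ?g n \<omega> * indicator A \<omega>))
      \<longlonglongrightarrow> expectation (\<lambda>\<omega>. 1 / (1 + real m * (Y \<omega>)\<^sup>2) * indicator A \<omega>)"
    proof (intro integral_dominated_convergence[where w="\<lambda>_. 1"])
      show "AE \<omega> in M. (\<lambda>n. ?g n \<omega> * indicator A \<omega>) \<longlonglongrightarrow> 1 / (1 + real m * (Y \<omega>)\<^sup>2) * indicator A \<omega>"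
        using rescaled_tendsto by eventually_elim (intro tendsto_intros ne)
    qed (auto intro!: AE_I2 bound[simplified] simp: indicator_def)
  qed
  have i1: "integrable M (\<lambda>\<omega>. 1 / (1 + real m * (Y \<omega>)\<^sup>2))" for m
    by (rule Bochner_Integration.integrable_bound[where f="\<lambda>_. 1 :: real"])
      (auto intro!: AE_I2 bound[simplified])
  have "(\<lambda>m. expectation (\<lambda>\<omega>. 1 / (1 + real m * (Y \<omega>)\<^sup>2) * indicator A \<omega>)) \<longlonglongrightarrow> expectation (\<lambda>_. 0)"
  proof (intro integral_dominated_convergence[where w="\<lambda>_. 1"])
    show "AE \<omega> in M. (\<lambda>m. 1 / (1 + real m * (Y \<omega>)\<^sup>2) * indicator A \<omega>) \<longlonglongrightarrow> 0"
    proof (rule AE_I2)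
      fix \<omega>
      show "(\<lambda>m. 1 / (1 + real m * (Y \<omega>)\<^sup>2) * indicator A \<omega>) \<longlonglongrightarrow> 0"
      proof (cases "\<omega> \<in> A")
        case True
        then have "0 < (Y \<omega>)\<^sup>2" by (simp add: A_def)
        moreover have "(\<lambda>m. 1 / (1 + real m * c)) \<longlonglongrightarrow> 0" if "0 < c" for c :: real
          using that by real_asymp
        ultimately have "(\<lambda>m. 1 / (1 + real m * (Y \<omega>)\<^sup>2)) \<longlonglongrightarrow> 0" by blast
        then show ?thesis using True by simp
      qed simp
    qed
  qed (auto intro!: AE_I2 bound[simplified] simp: indicator_def)
  moreover have "v\<^sup>2 / 16 * prob (space M - A) \<le> expectation (\<lambda>\<omega>. 1 / (1 + real m * (Y \<omega>)\<^sup>2) * indicator A \<omega>)" for m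
  proof -
    have "prob (space M - A) = expectation (indicator (space M - A))" by simp
    also have "\<dots> \<le> expectation (\<lambda>\<omega>. 1 / (1 + real m * (Y \<omega>)\<^sup>2))"
      by (intro integral_mono i1) (auto simp: A_def indicator_def emeasure_eq_measure)
    finally have "v\<^sup>2 / 16 * prob (space M - A) \<le> v\<^sup>2 / 16 * expectation (\<lambda>\<omega>. 1 / (1 + real m * (Y \<omega>)\<^sup>2))"
      by (intro mult_left_mono) auto
    then show ?thesis using key[of m] by (rule order_trans)
  qed
  ultimately have "v\<^sup>2 / 16 * prob (space M - A) \<le> 0"
    by (intro LIMSEQ_le_const[of _ "0::real"]) auto
  then have "prob (space M - A) = 0"
    using v measure_nonneg[of M "space M - A"] by (simp add: mult_le_0_iff)
  then have "AE \<omega> in M. \<omega> \<notin> space M - A" by (subst (asm) prob_eq_0) auto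
  then show ?thesis using AE_space by eventually_elim (auto simp: A_def)
qed

text \<open>
  For \<open>a = 1\<close> the mean position after \<open>n\<close> steps is \<open>n\<close>, which is also the largest possible
  position.  This covers an elephant that always repeats a remembered step, whose
  noise is degenerate.
\<close>

lemma limit_full_memory:
  assumes a1: "a = 1" and start: "\<And>\<omega>. \<omega> \<in> space M \<Longrightarrow> \<xi> 1 \<omega> = 1"
  shows "AE \<omega> in M. Y \<omega> = 1"
proof -
  have iX: "integrable M (X n)" for n by (rule integrable_stage[OF X_adapted])
  have mean: "expectation (X n) = real n" if "1 \<le> n" for n
    using that
  proof (induction n rule: dec_induct)
    case base
    have "expectation (X 1) = expectation (\<lambda>_. 1)"
      by (rule Bochner_Integration.integral_cong) (use start in \<open>auto simp: X_def\<close>)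
    then show ?case by (simp add: prob_space)
  next
    case (step n)
    have "integrable M (\<xi> (Suc n))" by (rule integrable_stage[OF step_adapted]) simp
    then have "expectation (X (Suc n)) = expectation (X n) + expectation (\<lambda>\<omega>. 1 * \<xi> (Suc n) \<omega>)"
      unfolding X_Suc using iX[of n] by simp
    then show ?case using X_drift[OF step(1), of "\<lambda>_. 1"] step a1 by simp
  qed
  have X_le: "X n \<omega> \<le> real n" for n \<omega>
  proof -
    have "X n \<omega> \<le> (\<Sum>i=1..n. 1)" unfolding X_def
      by (intro sum_mono) (metis abs_le_D1 step_bounded)
    then show ?thesis by simp
  qed
  have "AE \<omega> in M. X n \<omega> = real n" if "1 \<le> n" for n
  proof -
    have "expectation (\<lambda>\<omega>. real n - X n \<omega>) = 0" using mean[OF that] iX[of n] by (simp add: prob_space)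
    moreover have "integrable M (\<lambda>\<omega>. real n - X n \<omega>)" using iX by simp
    ultimately have "AE \<omega> in M. real n - X n \<omega> = 0"
      using X_le by (subst (asm) integral_nonneg_eq_0_iff_AE) auto
    then show ?thesis by eventually_elim simp
  qed
  then have "AE \<omega> in M. \<forall>n. 1 \<le> n \<longrightarrow> X n \<omega> = real n" unfolding AE_all_countable by auto
  then show ?thesis using rescaled_tendsto
  proof eventually_elim
    case (elim \<omega>)
    have "eventually (\<lambda>n. X n \<omega> / real n powr a = 1) sequentially"
      using eventually_ge_at_top[of 1] by eventually_elim (use elim a1 in auto)
    then have "(\<lambda>n. X n \<omega> / real n powr a) \<longlonglongrightarrow> 1" by (rule tendsto_eventually)
    then show ?case using elim(2) LIMSEQ_unique by blast
  qed
qed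

end

section \<open>Expectations of finitely valued functions\<close>

lemma (in prob_space) finitely_valued:
  fixes C :: "'a \<Rightarrow> 'i" and f :: "'a \<Rightarrow> real"
  assumes I: "finite I" "AE \<omega> in M. C \<omega> \<in> I"
    and cells: "\<And>i. i \<in> I \<Longrightarrow> {\<omega>\<in>space M. C \<omega> = i} \<in> sets M"
    and f: "f \<in> borel_measurable M" "\<And>\<omega>. \<omega> \<in> space M \<Longrightarrow> C \<omega> \<in> I \<Longrightarrow> f \<omega> = c (C \<omega>)"
  shows "integrable M f" "expectation f = (\<Sum>i\<in>I. c i * \<P>(\<omega> in M. C \<omega> = i))"
proof -
  let ?s = "\<lambda>\<omega>. \<Sum>i\<in>I. c i * indicator {\<omega>\<in>space M. C \<omega> = i} \<omega>"
  have i: "integrable M (\<lambda>\<omega>. c i * indicator {\<omega>\<in>space M. C \<omega> = i} \<omega>)" if "i \<in> I" for i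
    using cells[OF that] by (intro integrable_mult_right integrable_real_indicator) (auto simp: emeasure_eq_measure)
  have s: "integrable M ?s" using i by (rule Bochner_Integration.integrable_sum)
  have eq: "AE \<omega> in M. f \<omega> = ?s \<omega>"
    using I(2) AE_space
  proof eventually_elim
    case (elim \<omega>)
    have "?s \<omega> = (\<Sum>i\<in>I. if i = C \<omega> then c i else 0)"
      using elim by (intro sum.cong) (auto simp: indicator_def)
    then show ?case using elim I(1) f(2) by simp
  qed
  show "integrable M f"
    using integrable_cong_AE[OF f(1) borel_measurable_integrable[OF s] eq] s by simp
  have "expectation f = expectation ?s"
    by (rule integral_cong_AE[OF f(1) borel_measurable_integrable[OF s] eq])
  also have "\<dots> = (\<Sum>i\<in>I. c i * \<P>(\<omega> in M. C \<omega> = i))"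
    using i cells by (subst Bochner_Integration.integral_sum) (auto intro!: sum.cong)
  finally show "expectation f = (\<Sum>i\<in>I. c i * \<P>(\<omega> in M. C \<omega> = i))" .
qed

section \<open>Unit steps\<close>

lemma finite_unit_steps: "finite (unit_steps :: (real^'d::finite) set)"
  unfolding unit_steps_def by simp

lemma axis_neq_uminus_axis: "axis i 1 \<noteq> - (axis j 1 :: real^'d::finite)"
proof
  assume "axis i 1 = - (axis j 1 :: real^'d)"
  then have "axis i 1 $ i = - (axis j 1 :: real^'d) $ i" by simp
  then show False by (auto simp: axis_def split: if_splits)
qed

lemma card_unit_steps: "card (unit_steps :: (real^'d::finite) set) = 2 * CARD('d)"
proof -
  have ne: "axis i 1 \<noteq> - (axis j 1 :: real^'d)" for i j by (rule axis_neq_uminus_axis)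
  have "card (unit_steps :: (real^'d) set) = (\<Sum>i\<in>UNIV. card {axis i 1, - axis i 1 :: real^'d})"
    unfolding unit_steps_def
    using ne ne[symmetric] by (intro card_UN_disjoint) (auto simp: axis_eq_axis)
  also have "\<dots> = (\<Sum>i\<in>(UNIV :: 'd set). 2)"
    using ne by (intro sum.cong) auto
  finally show ?thesis by simp
qed

lemma uminus_unit_steps: "v \<in> unit_steps \<Longrightarrow> - v \<in> unit_steps"
  unfolding unit_steps_def by auto

lemma sum_unit_steps: "(\<Sum>v\<in>unit_steps. v $ i) = (0 :: real)"
proof -
  have "(\<Sum>v\<in>unit_steps. v $ i) = (\<Sum>v\<in>unit_steps. - (v $ i) :: real)"
    by (rule sum.reindex_bij_witness[of _ uminus uminus]) (auto intro: uminus_unit_steps)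
  then show ?thesis by (simp add: sum_negf)
qed

lemma unit_steps_component: "v \<in> unit_steps \<Longrightarrow> \<bar>v $ i\<bar> \<le> (1::real)"
  unfolding unit_steps_def by (auto simp: axis_def)

text \<open>
  Truncating outside the unit steps makes the coordinate bounded everywhere instead of
  almost everywhere.
\<close>

definition coord :: "'d \<Rightarrow> real^'d \<Rightarrow> real" where
  "coord i v = (if v \<in> unit_steps then v $ i else 0)"

lemma coord_measurable[measurable]: "coord (i :: 'd::finite) \<in> borel_measurable borel"
proof -
  have [measurable]: "unit_steps \<in> sets (borel :: (real^'d) measure)"
    using finite_unit_steps by (intro borel_closed finite_imp_closed)
  show ?thesis unfolding coord_def[abs_def] by measurable
qed

section \<open>The elephant random walk\<close>

context elephant_random_walk begin

definition q :: real where "q = (1 - p) / (2 * real CARD('d) - 1)"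

text \<open>
  The probability of the step \<open>v\<close> when the step \<open>s\<close> is remembered.
\<close>

definition step_law :: "real^'d \<Rightarrow> real^'d \<Rightarrow> real" where
  "step_law s v = (if v = s then p else q)"

definition stage :: "nat \<Rightarrow> 'w measure" where
  "stage n = vimage_algebra (space M) (past \<tau> \<sigma> n) (past_space n)"

text \<open>
  The finitely many pasts that occur with positive probability are among these.
\<close>

definition outcomes :: "nat \<Rightarrow> ((nat \<Rightarrow> real^'d) \<times> (nat \<Rightarrow> nat)) set" where
  "outcomes n = ({1..n} \<rightarrow>\<^sub>E unit_steps) \<times> (\<Pi>\<^sub>E i\<in>{1..<n}. {1..i})"

lemma dim_pos: "0 < 2 * real CARD('d) - 1"
proof -
  have "0 < CARD('d)" by simp
  then have "1 \<le> real CARD('d)" by linarith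
  then show ?thesis by linarith
qed

lemma q_nonneg: "0 \<le> q"
  unfolding q_def using p_range dim_pos by simp

lemma step_law_sum:
  assumes "s \<in> unit_steps"
  shows "(\<Sum>v\<in>unit_steps. f v * step_law s v) = q * (\<Sum>v\<in>unit_steps. f v) + (p - q) * f s"
proof -
  have "(\<Sum>v\<in>unit_steps. f v * step_law s v) = (\<Sum>v\<in>unit_steps. q * f v + (if v = s then (p - q) * f s else 0))"
    by (intro sum.cong) (auto simp: step_law_def algebra_simps)
  then show ?thesis using assms by (simp add: sum.distrib sum_distrib_left finite_unit_steps)
qed

lemma step_law_total: "s \<in> unit_steps \<Longrightarrow> (\<Sum>v\<in>unit_steps. step_law s v) = 1"
proof -
  assume "s \<in> unit_steps"
  then have "(\<Sum>v\<in>unit_steps. step_law s v) = q * (2 * real CARD('d) - 1) + p"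
    using step_law_sum[of s "\<lambda>_. 1"] by (simp add: card_unit_steps algebra_simps)
  then show ?thesis using dim_pos by (simp add: q_def)
qed

lemma p_minus_q: "p - q = scaling_exponent CARD('d) p"
  using dim_pos by (simp add: q_def scaling_exponent_def field_simps)

text \<open>
  The mean of all unit steps is zero, so only the excess \<open>p - q\<close> of the remembered step survives.
\<close>

lemma step_law_mean:
  "s \<in> unit_steps \<Longrightarrow> (\<Sum>v\<in>unit_steps. coord i v * step_law s v) = scaling_exponent CARD('d) p * coord i s"
proof -
  assume s: "s \<in> unit_steps"
  have "(\<Sum>v\<in>unit_steps. coord i v) = 0"
    using sum_unit_steps[of i] by (simp add: coord_def cong: sum.cong)
  then show ?thesis using step_law_sum[OF s, of "coord i"] by (simp add: p_minus_q)
qed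

text \<open>
  Already the two unit steps along the axis \<open>i\<close> give this much.
\<close>

lemma step_law_noise:
  assumes "s \<in> unit_steps"
  shows "2 * min p q \<le> (\<Sum>v\<in>unit_steps. (coord i v)\<^sup>2 * step_law s v)"
proof -
  have ne: "axis i 1 \<noteq> (- axis i 1 :: real^'d)" by (rule axis_neq_uminus_axis)
  have mem: "axis i 1 \<in> unit_steps" "- axis i 1 \<in> (unit_steps :: (real^'d) set)"
    by (auto simp: unit_steps_def)
  have "2 * min p q \<le> (\<Sum>v\<in>{axis i 1, - axis i 1}. (coord i v)\<^sup>2 * step_law s v)"
    using ne mem by (simp add: coord_def step_law_def) linarith
  also have "\<dots> \<le> (\<Sum>v\<in>unit_steps. (coord i v)\<^sup>2 * step_law s v)"
    using mem p_range q_nonneg by (intro sum_mono2 finite_unit_steps) (auto simp: step_law_def)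
  finally show ?thesis .
qed

lemma past_measurable: "past \<tau> \<sigma> n \<in> measurable M (past_space n)"
  unfolding past_def[abs_def] past_space_def
  by (intro measurable_Pair measurable_restrict measurable_step measurable_memory) auto

lemma past_in_space: "past \<tau> \<sigma> n \<omega> \<in> space (past_space n)"
  by (auto simp: past_def past_space_def space_pair_measure space_PiM)

lemma outcomes_in_space: "outcomes n \<subseteq> space (past_space n)"
  by (auto simp: outcomes_def past_space_def space_pair_measure space_PiM PiE_iff)

lemma finite_outcomes: "finite (outcomes n)"
  unfolding outcomes_def by (intro finite_cartesian_product finite_PiE finite_unit_steps) auto

lemma singleton_past: "h \<in> space (past_space n) \<Longrightarrow> {h} \<in> sets (past_space n)"
proof -
  assume "h \<in> space (past_space n)"
  then obtain s t where h: "h = (s, t)" "s \<in> extensional {1..n}" "t \<in> extensional {1..<n}"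
    by (auto simp: past_space_def space_pair_measure space_PiM PiE_iff)
  have "(\<Pi>\<^sub>E i\<in>{1..n}. {s i}) \<times> (\<Pi>\<^sub>E i\<in>{1..<n}. {t i}) \<in> sets (past_space n)"
    unfolding past_space_def by (intro pair_measureI sets_PiM_I_finite) auto
  then show ?thesis using h by (simp add: PiE_singleton)
qed

lemma past_event_stage: "h \<in> space (past_space n) \<Longrightarrow> {\<omega>\<in>space M. past \<tau> \<sigma> n \<omega> = h} \<in> sets (stage n)"
  using in_vimage_algebra[OF singleton_past, of h n "past \<tau> \<sigma> n" "space M"]
  by (simp add: stage_def vimage_def Int_def conj_commute)

lemma stage_subalgebra: "subalgebra M (stage n)"
  unfolding subalgebra_def stage_def
  using measurable_sets[OF past_measurable] past_in_space
  by (auto simp: sets_vimage_algebra2)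

lemma past_event: "h \<in> space (past_space n) \<Longrightarrow> {\<omega>\<in>space M. past \<tau> \<sigma> n \<omega> = h} \<in> sets M"
  using past_event_stage[of h n] stage_subalgebra[of n] by (simp add: subalgebra_def subset_eq)

lemma past_stage_measurable: "past \<tau> \<sigma> n \<in> measurable (stage n) (past_space n)"
  unfolding stage_def using past_in_space by (intro measurable_vimage_algebra1) auto

lemma step_stage: "1 \<le> i \<Longrightarrow> i \<le> n \<Longrightarrow> \<sigma> i \<in> borel_measurable (stage n)"
proof -
  assume i: "1 \<le> i" "i \<le> n"
  have "(\<lambda>\<omega>. fst (past \<tau> \<sigma> n \<omega>) i) \<in> borel_measurable (stage n)"
    using measurable_compose[OF past_stage_measurable[unfolded past_space_def] measurable_fst]
    by (rule measurable_compose[OF _ measurable_component_singleton]) (use i in auto)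
  then show ?thesis using i by (simp add: past_def)
qed

lemma memory_stage: "1 \<le> i \<Longrightarrow> i < n \<Longrightarrow> \<tau> i \<in> measurable (stage n) (count_space UNIV)"
proof -
  assume i: "1 \<le> i" "i < n"
  have "(\<lambda>\<omega>. snd (past \<tau> \<sigma> n \<omega>) i) \<in> measurable (stage n) (count_space UNIV)"
    using measurable_compose[OF past_stage_measurable[unfolded past_space_def] measurable_snd]
    by (rule measurable_compose[OF _ measurable_component_singleton]) (use i in auto)
  then show ?thesis using i by (simp add: past_def)
qed

lemma stage_mono: "m \<le> n \<Longrightarrow> subalgebra (stage n) (stage m)"
proof -
  assume mn: "m \<le> n"
  have m: "past \<tau> \<sigma> m \<in> measurable (stage n) (past_space m)"
    unfolding past_def[abs_def] past_space_def
    using mn by (intro measurable_Pair measurable_restrict step_stage memory_stage) auto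
  have sp: "space (stage n) = space M" for n by (simp add: stage_def)
  show ?thesis
    unfolding subalgebra_def sp
    using measurable_sets[OF m] past_in_space unfolding sp
    by (auto simp: stage_def[of m] sets_vimage_algebra2)
qed

lemma memory_AE: "1 \<le> n \<Longrightarrow> AE \<omega> in M. \<tau> n \<omega> \<in> {1..n}"
proof -
  assume n: "1 \<le> n"
  have "AE j in distr M (count_space UNIV) (\<tau> n). j \<in> {1..n}"
    unfolding memory_uniform[OF n] using n by (auto simp: AE_measure_pmf_iff set_pmf_of_set)
  then show ?thesis using AE_distrD[OF measurable_memory[OF n]] by blast
qed

lemma memory_law: "1 \<le> n \<Longrightarrow> j \<in> {1..n} \<Longrightarrow> \<P>(\<omega> in M. \<tau> n \<omega> = j) = 1 / real n"
proof -
  assume n: "1 \<le> n" "j \<in> {1..n}"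
  have "\<P>(\<omega> in M. \<tau> n \<omega> = j) = measure (distr M (count_space UNIV) (\<tau> n)) {j}"
    using measurable_memory[OF n(1)] by (subst measure_distr) (auto intro!: arg_cong[where f=prob])
  also have "\<dots> = 1 / real n"
    unfolding memory_uniform[OF n(1)] using n by (simp add: measure_pmf_single)
  finally show ?thesis .
qed

lemma memory_event: "1 \<le> n \<Longrightarrow> {\<omega>\<in>space M. \<tau> n \<omega> = j} \<in> sets M"
  using measurable_sets[OF measurable_memory, of n "{j}"] by (simp add: vimage_def Int_def conj_commute)

lemma past_memory_law:
  assumes n: "1 \<le> n" and h: "h \<in> space (past_space n)" and j: "j \<in> {1..n}"
  shows "\<P>(\<omega> in M. past \<tau> \<sigma> n \<omega> = h \<and> \<tau> n \<omega> = j) = \<P>(\<omega> in M. past \<tau> \<sigma> n \<omega> = h) / real n"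
proof -
  have "{\<omega>\<in>space M. \<tau> n \<omega> = j} \<in> sets (vimage_algebra (space M) (\<tau> n) (count_space UNIV))"
    using in_vimage_algebra[of "{j}" "count_space UNIV" "\<tau> n" "space M"]
    by (simp add: vimage_def Int_def conj_commute)
  from indep_setD[OF memory_indep[OF n] past_event_stage[OF h, unfolded stage_def] this]
  have "prob ({\<omega>\<in>space M. past \<tau> \<sigma> n \<omega> = h} \<inter> {\<omega>\<in>space M. \<tau> n \<omega> = j})
      = \<P>(\<omega> in M. past \<tau> \<sigma> n \<omega> = h) * (1 / real n)"
    using memory_law[OF n j] by simp
  moreover have "{\<omega>\<in>space M. past \<tau> \<sigma> n \<omega> = h} \<inter> {\<omega>\<in>space M. \<tau> n \<omega> = j}
      = {\<omega>\<in>space M. past \<tau> \<sigma> n \<omega> = h \<and> \<tau> n \<omega> = j}" by auto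
  ultimately show ?thesis by simp
qed

lemma joint_event:
  assumes n: "1 \<le> n" and h: "h \<in> space (past_space n)"
  shows "{\<omega>\<in>space M. (past \<tau> \<sigma> n \<omega>, \<tau> n \<omega>, \<sigma> (Suc n) \<omega>) = (h, j, v)} \<in> sets M"
proof -
  have [measurable]: "\<sigma> (Suc n) \<in> borel_measurable M" by (rule measurable_step) simp
  have "{\<omega>\<in>space M. \<sigma> (Suc n) \<omega> = v} \<in> sets M" by measurable
  moreover have "{\<omega>\<in>space M. (past \<tau> \<sigma> n \<omega>, \<tau> n \<omega>, \<sigma> (Suc n) \<omega>) = (h, j, v)} =
    {\<omega>\<in>space M. past \<tau> \<sigma> n \<omega> = h} \<inter> ({\<omega>\<in>space M. \<tau> n \<omega> = j} \<inter> {\<omega>\<in>space M. \<sigma> (Suc n) \<omega> = v})" by auto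
  ultimately show ?thesis using past_event[OF h] memory_event[OF n] by auto
qed

text \<open>
  When the condition has probability zero both sides vanish, so that no positivity assumption
  is left and the law can be summed over all outcomes.
\<close>

lemma joint_law:
  assumes n: "1 \<le> n" and h: "h \<in> space (past_space n)" and j: "j \<in> {1..n}" and v: "v \<in> unit_steps"
  shows "\<P>(\<omega> in M. (past \<tau> \<sigma> n \<omega>, \<tau> n \<omega>, \<sigma> (Suc n) \<omega>) = (h, j, v))
    = step_law (fst h j) v * (\<P>(\<omega> in M. past \<tau> \<sigma> n \<omega> = h) / real n)"
proof -
  obtain s t where st: "h = (s, t)" by (cases h)
  let ?Q = "\<P>(\<omega> in M. past \<tau> \<sigma> n \<omega> = h \<and> \<tau> n \<omega> = j)"
  have Qm: "{\<omega>\<in>space M. past \<tau> \<sigma> n \<omega> = h \<and> \<tau> n \<omega> = j} \<in> sets M"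
  proof -
    have "{\<omega>\<in>space M. past \<tau> \<sigma> n \<omega> = h} \<inter> {\<omega>\<in>space M. \<tau> n \<omega> = j} \<in> sets M"
      using past_event[OF h] memory_event[OF n] by auto
    then show ?thesis by (simp add: Int_def conj_ac cong: conj_cong)
  qed
  have eq: "\<P>(\<omega> in M. (past \<tau> \<sigma> n \<omega>, \<tau> n \<omega>, \<sigma> (Suc n) \<omega>) = (h, j, v))
      = \<P>(\<omega> in M. \<sigma> (Suc n) \<omega> = v \<and> past \<tau> \<sigma> n \<omega> = h \<and> \<tau> n \<omega> = j)"
    by (rule arg_cong[where f=prob]) auto
  have "\<P>(\<omega> in M. (past \<tau> \<sigma> n \<omega>, \<tau> n \<omega>, \<sigma> (Suc n) \<omega>) = (h, j, v)) = step_law (fst h j) v * ?Q"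
  proof (cases "?Q > 0")
    case True
    from next_step[OF n j v, of s t] True
    have "\<P>(\<omega> in M. \<sigma> (Suc n) \<omega> = v \<bar> past \<tau> \<sigma> n \<omega> = h \<and> \<tau> n \<omega> = j) = step_law (fst h j) v"
      unfolding st by (simp add: step_law_def q_def)
    then show ?thesis unfolding eq using True by (simp add: cond_prob_def field_simps)
  next
    case False
    then have Q0: "?Q = 0"
      using measure_nonneg[of M "{\<omega>\<in>space M. past \<tau> \<sigma> n \<omega> = h \<and> \<tau> n \<omega> = j}"] by linarith
    have le: "\<P>(\<omega> in M. (past \<tau> \<sigma> n \<omega>, \<tau> n \<omega>, \<sigma> (Suc n) \<omega>) = (h, j, v)) \<le> ?Q"
      by (rule finite_measure_mono[OF _ Qm]) auto
    show ?thesis unfolding Q0 mult_zero_right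
      by (rule order_antisym[OF le[unfolded Q0] measure_nonneg])
  qed
  then show ?thesis using past_memory_law[OF n h j] by simp
qed

lemma joint_sum:
  assumes n: "1 \<le> n"
  shows "(\<Sum>i\<in>outcomes n \<times> {1..n} \<times> unit_steps. c i * \<P>(\<omega> in M. (past \<tau> \<sigma> n \<omega>, \<tau> n \<omega>, \<sigma> (Suc n) \<omega>) = i)) =
    (\<Sum>h\<in>outcomes n. \<Sum>j\<in>{1..n}. \<Sum>v\<in>unit_steps.
        c (h, j, v) * (step_law (fst h j) v * (\<P>(\<omega> in M. past \<tau> \<sigma> n \<omega> = h) / real n)))"
  unfolding sum.cartesian_product
proof (rule sum.cong[OF refl])
  fix i :: "((nat \<Rightarrow> real^'d) \<times> (nat \<Rightarrow> nat)) \<times> nat \<times> (real^'d)"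
  assume "i \<in> outcomes n \<times> {1..n} \<times> unit_steps"
  then obtain h j v where i: "i = (h, j, v)" "h \<in> outcomes n" "j \<in> {1..n}" "v \<in> unit_steps" by blast
  have "\<P>(\<omega> in M. (past \<tau> \<sigma> n \<omega>, \<tau> n \<omega>, \<sigma> (Suc n) \<omega>) = i)
      = step_law (fst h j) v * (\<P>(\<omega> in M. past \<tau> \<sigma> n \<omega> = h) / real n)"
    unfolding i(1) by (rule joint_law[OF n _ i(3,4)]) (use i(2) outcomes_in_space in blast)
  then show "c i * \<P>(\<omega> in M. (past \<tau> \<sigma> n \<omega>, \<tau> n \<omega>, \<sigma> (Suc n) \<omega>) = i) =
    (case i of (h, j, v) \<Rightarrow> c (h, j, v) * (step_law (fst h j) v * (\<P>(\<omega> in M. past \<tau> \<sigma> n \<omega> = h) / real n)))"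
    unfolding i(1) by simp
qed

lemma outcomes_Suc:
  assumes "1 \<le> n" "past \<tau> \<sigma> n \<omega> \<in> outcomes n" "\<tau> n \<omega> \<in> {1..n}" "\<sigma> (Suc n) \<omega> \<in> unit_steps"
  shows "past \<tau> \<sigma> (Suc n) \<omega> \<in> outcomes (Suc n)"
  using assms by (auto simp: past_def outcomes_def PiE_iff less_Suc_eq le_Suc_eq)

text \<open>
  By induction, the joint probabilities of past, memory and next step sum to \<open>1\<close> over the
  admissible outcomes: \<open>step_law\<close> is a probability on the unit steps and the memory is uniform.
\<close>

lemma past_AE: "AE \<omega> in M. past \<tau> \<sigma> n \<omega> \<in> outcomes n"
proof (cases "n = 0")
  case True then show ?thesis by (intro AE_I2) (simp add: past_def outcomes_def restrict_def)
next
  case False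
  then have "1 \<le> n" by simp
  then show ?thesis
  proof (induction n rule: dec_induct)
    case base
    have "axis k 1 \<in> (unit_steps :: (real^'d) set)" by (auto simp: unit_steps_def)
    then show ?case using first_step by (intro AE_I2) (auto simp: past_def outcomes_def PiE_iff)
  next
    case (step n)
    let ?J = "\<lambda>\<omega>. (past \<tau> \<sigma> n \<omega>, \<tau> n \<omega>, \<sigma> (Suc n) \<omega>)"
    let ?I = "outcomes n \<times> {1..n} \<times> (unit_steps :: (real^'d) set)"
    have fin: "finite ?I" using finite_outcomes finite_unit_steps by auto
    have ev: "{\<omega>\<in>space M. ?J \<omega> = i} \<in> sets M" if "i \<in> ?I" for i
      using that joint_event[OF step(1)] outcomes_in_space by (cases i) blast
    have U: "{\<omega>\<in>space M. ?J \<omega> \<in> ?I} = (\<Union>i\<in>?I. {\<omega>\<in>space M. ?J \<omega> = i})" by auto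
    have evI: "{\<omega>\<in>space M. ?J \<omega> \<in> ?I} \<in> sets M"
      unfolding U by (rule sets.finite_UN[OF fin]) (rule ev)
    have total: "(\<Sum>h\<in>outcomes n. \<P>(\<omega> in M. past \<tau> \<sigma> n \<omega> = h)) = 1"
      using finitely_valued(2)[OF finite_outcomes step.IH, of "\<lambda>_. 1" "\<lambda>_. 1"] past_event outcomes_in_space
      by (auto simp: prob_space subset_eq)
    have "\<P>(\<omega> in M. ?J \<omega> \<in> ?I) = (\<Sum>i\<in>?I. \<P>(\<omega> in M. ?J \<omega> = i))"
      unfolding U using ev fin by (intro finite_measure_finite_Union) (auto simp: disjoint_family_on_def)
    also have "\<dots> = (\<Sum>h\<in>outcomes n. \<Sum>j\<in>{1..n}. \<Sum>v\<in>unit_steps.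
        step_law (fst h j) v * (\<P>(\<omega> in M. past \<tau> \<sigma> n \<omega> = h) / real n))"
      using joint_sum[OF step(1), of "\<lambda>_. 1"] by simp
    also have "\<dots> = (\<Sum>h\<in>outcomes n. \<Sum>j\<in>{1..n}. \<P>(\<omega> in M. past \<tau> \<sigma> n \<omega> = h) / real n)"
    proof (intro sum.cong refl)
      fix h j assume "h \<in> outcomes n" "j \<in> {1..n}"
      then have "fst h j \<in> unit_steps" by (auto simp: outcomes_def PiE_iff)
      then show "(\<Sum>v\<in>unit_steps. step_law (fst h j) v * (\<P>(\<omega> in M. past \<tau> \<sigma> n \<omega> = h) / real n))
          = \<P>(\<omega> in M. past \<tau> \<sigma> n \<omega> = h) / real n"
        unfolding sum_distrib_right[symmetric] by (simp add: step_law_total)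
    qed
    also have "\<dots> = 1" using step(1) total by simp
    finally have "AE \<omega> in M. ?J \<omega> \<in> ?I"
      using evI by (simp only: prob_Collect_eq_1)
    then show ?case by eventually_elim (use outcomes_Suc[OF step(1)] in auto)
  qed
qed

lemma steps_AE: "AE \<omega> in M. \<forall>n\<ge>1. \<sigma> n \<omega> \<in> unit_steps"
proof -
  have "AE \<omega> in M. \<forall>n. past \<tau> \<sigma> n \<omega> \<in> outcomes n" unfolding AE_all_countable using past_AE by blast
  then show ?thesis
  proof eventually_elim
    case (elim \<omega>)
    show ?case
    proof (intro allI impI)
      fix n :: nat assume "1 \<le> n"
      then show "\<sigma> n \<omega> \<in> unit_steps" using elim[rule_format, of n] by (auto simp: past_def outcomes_def PiE_iff)
    qed
  qed
qed

text \<open>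
  Measurability with respect to the past means being a function of the past; the function itself
  is \<open>on_past\<close> below.
\<close>

lemma stage_constant_on_past:
  fixes g :: "'w \<Rightarrow> real"
  assumes g: "g \<in> borel_measurable (stage n)" and w: "\<omega> \<in> space M" "\<omega>' \<in> space M"
    and eq: "past \<tau> \<sigma> n \<omega> = past \<tau> \<sigma> n \<omega>'"
  shows "g \<omega> = g \<omega>'"
proof -
  have "g -` {g \<omega>} \<inter> space (stage n) \<in> sets (stage n)"
    by (rule measurable_sets[OF g]) simp
  then obtain B where "g -` {g \<omega>} \<inter> space M = past \<tau> \<sigma> n -` B \<inter> space M"
    using past_in_space by (auto simp: stage_def sets_vimage_algebra2)
  then show ?thesis using w eq by (metis IntD1 IntI insertI1 singletonD vimageE vimageI)
qed

definition on_past :: "('w \<Rightarrow> real) \<Rightarrow> nat \<Rightarrow> (nat \<Rightarrow> real^'d) \<times> (nat \<Rightarrow> nat) \<Rightarrow> real" where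
  "on_past g n h = g (SOME \<omega>. \<omega> \<in> space M \<and> past \<tau> \<sigma> n \<omega> = h)"

lemma on_past:
  assumes g: "g \<in> borel_measurable (stage n)" and w: "\<omega> \<in> space M"
  shows "g \<omega> = on_past g n (past \<tau> \<sigma> n \<omega>)"
proof -
  have "(SOME \<omega>'. \<omega>' \<in> space M \<and> past \<tau> \<sigma> n \<omega>' = past \<tau> \<sigma> n \<omega>) \<in> space M \<and>
    past \<tau> \<sigma> n (SOME \<omega>'. \<omega>' \<in> space M \<and> past \<tau> \<sigma> n \<omega>' = past \<tau> \<sigma> n \<omega>) = past \<tau> \<sigma> n \<omega>"
    by (rule someI[of _ \<omega>]) (use w in simp)
  then show ?thesis unfolding on_past_def using stage_constant_on_past[OF g w] by metis
qed

lemma stage_expectation: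
  assumes g: "g \<in> borel_measurable (stage n)"
    and c: "\<And>\<omega>. \<omega> \<in> space M \<Longrightarrow> past \<tau> \<sigma> n \<omega> \<in> outcomes n \<Longrightarrow> g \<omega> = c (past \<tau> \<sigma> n \<omega>)"
  shows "integrable M g" "expectation g = (\<Sum>h\<in>outcomes n. c h * \<P>(\<omega> in M. past \<tau> \<sigma> n \<omega> = h))"
  using finitely_valued[OF finite_outcomes past_AE _ measurable_from_subalg[OF stage_subalgebra g] c]
    past_event outcomes_in_space by (auto simp: subset_eq)

text \<open>
  The conditional expectation of a function \<open>f\<close> of the next step, tested against a function of the
  past: the memory is averaged over \<open>{1..n}\<close> and the step over its law given the remembered step.
\<close>

lemma next_step_expectation:
  assumes n: "1 \<le> n" and g: "g \<in> borel_measurable (stage n)" and f: "f \<in> borel_measurable borel"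
  shows "expectation (\<lambda>\<omega>. g \<omega> * f (\<sigma> (Suc n) \<omega>)) =
    (\<Sum>h\<in>outcomes n. on_past g n h * \<P>(\<omega> in M. past \<tau> \<sigma> n \<omega> = h) / real n *
       (\<Sum>j\<in>{1..n}. \<Sum>v\<in>unit_steps. f v * step_law (fst h j) v))"
proof -
  let ?J = "\<lambda>\<omega>. (past \<tau> \<sigma> n \<omega>, \<tau> n \<omega>, \<sigma> (Suc n) \<omega>)"
  let ?I = "outcomes n \<times> {1..n} \<times> (unit_steps :: (real^'d) set)"
  have fin: "finite ?I" using finite_outcomes finite_unit_steps by auto
  have ev: "{\<omega>\<in>space M. ?J \<omega> = i} \<in> sets M" if "i \<in> ?I" for i
    using that joint_event[OF n] outcomes_in_space by (cases i) blast
  have AEJ: "AE \<omega> in M. ?J \<omega> \<in> ?I"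
    using past_AE[of n] memory_AE[OF n] steps_AE by eventually_elim auto
  have [measurable]: "\<sigma> (Suc n) \<in> borel_measurable M" by (rule measurable_step) simp
  have [measurable]: "g \<in> borel_measurable M" by (rule measurable_from_subalg[OF stage_subalgebra g])
  note [measurable] = f
  have "expectation (\<lambda>\<omega>. g \<omega> * f (\<sigma> (Suc n) \<omega>)) =
     (\<Sum>i\<in>?I. (case i of (h, j, v) \<Rightarrow> on_past g n h * f v) * \<P>(\<omega> in M. ?J \<omega> = i))"
    by (rule finitely_valued(2)[OF fin AEJ ev]) (auto simp: on_past[OF g])
  also have "\<dots> = (\<Sum>h\<in>outcomes n. \<Sum>j\<in>{1..n}. \<Sum>v\<in>unit_steps.
        on_past g n h * f v * (step_law (fst h j) v * (\<P>(\<omega> in M. past \<tau> \<sigma> n \<omega> = h) / real n)))"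
    unfolding joint_sum[OF n] by simp
  also have "\<dots> = (\<Sum>h\<in>outcomes n. on_past g n h * \<P>(\<omega> in M. past \<tau> \<sigma> n \<omega> = h) / real n *
       (\<Sum>j\<in>{1..n}. \<Sum>v\<in>unit_steps. f v * step_law (fst h j) v))"
    unfolding sum_distrib_left by (intro sum.cong refl) (simp add: mult_ac)
  finally show ?thesis .
qed

text \<open>
  Averaging the law of the next step over the uniformly chosen memory gives the drift
  \<open>(a / n) * X n\<close> in every coordinate, and every remembered step leaves noise at least
  \<open>2 * min p q\<close>.  The condition on \<open>p\<close> is equivalent to \<open>a > 1 / 2\<close>.
\<close>

lemma coordinate_reinforcement:
  assumes crit: "critical_param CARD('d) < p"
  shows "linear_reinforcement M stage (\<lambda>n \<omega>. coord i (\<sigma> n \<omega>)) (scaling_exponent CARD('d) p) (2 * min p q)"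
proof
  let ?a = "scaling_exponent CARD('d) p"
  have pos: "0 < real CARD('d)" by simp
  show "1 / 2 < ?a"
    using crit dim_pos pos unfolding critical_param_def scaling_exponent_def by (simp add: field_simps)
  show "?a \<le> 1"
    using p_range(2) dim_pos pos unfolding scaling_exponent_def by (simp add: field_simps)
  show "subalgebra M (stage n)" for n by (rule stage_subalgebra)
  show "subalgebra (stage n) (stage m)" if "m \<le> n" for m n by (rule stage_mono[OF that])
  show "integrable M g" if "g \<in> borel_measurable (stage n)" for n and g :: "'w \<Rightarrow> real"
    using stage_expectation(1)[OF that on_past[OF that]] by blast
  show "0 \<le> 2 * min p q" using p_range q_nonneg by simp
  show "\<bar>coord i (\<sigma> n \<omega>)\<bar> \<le> 1" for n \<omega>
    using unit_steps_component[of "\<sigma> n \<omega>" i] by (simp add: coord_def)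
  show "(\<lambda>\<omega>. coord i (\<sigma> n \<omega>)) \<in> borel_measurable (stage n)" if "1 \<le> n" for n
    using measurable_compose[OF step_stage[OF that order_refl] coord_measurable] .
  fix n :: nat and g :: "'w \<Rightarrow> real"
  assume n: "1 \<le> n" and g: "g \<in> borel_measurable (stage n)"
  let ?P = "\<lambda>h. \<P>(\<omega> in M. past \<tau> \<sigma> n \<omega> = h)"
  have unit: "fst h j \<in> unit_steps" if "h \<in> outcomes n" "j \<in> {1..n}" for h j
    using that by (auto simp: outcomes_def PiE_iff)
  show "expectation (\<lambda>\<omega>. g \<omega> * coord i (\<sigma> (Suc n) \<omega>)) =
      ?a / real n * expectation (\<lambda>\<omega>. g \<omega> * (\<Sum>j=1..n. coord i (\<sigma> j \<omega>)))"
  proof -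
    define S where "S h = (\<Sum>j\<in>{1..n}. coord i (fst h j))" for h :: "(nat \<Rightarrow> real^'d) \<times> (nat \<Rightarrow> nat)"
    have "expectation (\<lambda>\<omega>. g \<omega> * coord i (\<sigma> (Suc n) \<omega>)) =
      (\<Sum>h\<in>outcomes n. on_past g n h * ?P h / real n * (\<Sum>j\<in>{1..n}. ?a * coord i (fst h j)))"
      unfolding next_step_expectation[OF n g coord_measurable]
      using step_law_mean unit by (intro sum.cong arg_cong2[where f="(*)"] refl) auto
    also have "\<dots> = ?a / real n * (\<Sum>h\<in>outcomes n. on_past g n h * S h * ?P h)"
      unfolding sum_distrib_left[symmetric] S_def[symmetric] by (simp add: sum_distrib_left mult_ac)
    also have "(\<Sum>h\<in>outcomes n. on_past g n h * S h * ?P h)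
      = expectation (\<lambda>\<omega>. g \<omega> * (\<Sum>j=1..n. coord i (\<sigma> j \<omega>)))"
    proof (rule stage_expectation(2)[symmetric])
      have "(\<lambda>\<omega>. coord i (\<sigma> j \<omega>)) \<in> borel_measurable (stage n)" if "j \<in> {1..n}" for j
        using that by (intro measurable_compose[OF step_stage coord_measurable]) auto
      then show "(\<lambda>\<omega>. g \<omega> * (\<Sum>j=1..n. coord i (\<sigma> j \<omega>))) \<in> borel_measurable (stage n)"
        by (intro borel_measurable_times g borel_measurable_sum)
      fix \<omega> assume w: "\<omega> \<in> space M"
      have "fst (past \<tau> \<sigma> n \<omega>) j = \<sigma> j \<omega>" if "j \<in> {1..n}" for j using that by (simp add: past_def)
      then show "g \<omega> * (\<Sum>j=1..n. coord i (\<sigma> j \<omega>)) =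
        on_past g n (past \<tau> \<sigma> n \<omega>) * S (past \<tau> \<sigma> n \<omega>)"
        using on_past[OF g w] by (simp add: S_def)
    qed
    finally show ?thesis .
  qed
  assume g0: "\<And>\<omega>. 0 \<le> g \<omega>"
  show "2 * min p q * expectation g \<le> expectation (\<lambda>\<omega>. g \<omega> * (coord i (\<sigma> (Suc n) \<omega>))\<^sup>2)"
  proof -
    have "2 * min p q * expectation g = (\<Sum>h\<in>outcomes n. on_past g n h * ?P h / real n * (\<Sum>j\<in>{1..n}. 2 * min p q))"
      using stage_expectation(2)[OF g on_past[OF g]] n by (simp add: sum_distrib_left mult_ac)
    also have "\<dots> \<le> (\<Sum>h\<in>outcomes n. on_past g n h * ?P h / real n *
        (\<Sum>j\<in>{1..n}. \<Sum>v\<in>unit_steps. (coord i v)\<^sup>2 * step_law (fst h j) v))"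
      using g0 step_law_noise unit
      by (intro sum_mono mult_left_mono) (auto simp: on_past_def intro!: divide_nonneg_nonneg mult_nonneg_nonneg)
    also have "\<dots> = expectation (\<lambda>\<omega>. g \<omega> * (coord i (\<sigma> (Suc n) \<omega>))\<^sup>2)"
      by (rule next_step_expectation[OF n g, of "\<lambda>v. (coord i v)\<^sup>2", symmetric]) measurable
    finally show ?thesis .
  qed
qed

end

theorem proposition1p5:
  fixes M :: "'w measure"
    and p :: real
    and k :: "'d::finite"
    and \<tau> :: "nat \<Rightarrow> 'w \<Rightarrow> nat"
    and \<sigma> :: "nat \<Rightarrow> 'w \<Rightarrow> real^'d"
  assumes "elephant_random_walk M p k \<tau> \<sigma>"
    and "critical_param CARD('d) < p"
  shows "(AE \<omega> in M. (\<lambda>n. rescaled_walk p \<sigma> n \<omega>) \<longlonglongrightarrow> limit_vector p \<sigma> \<omega>)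
    \<and> \<P>(\<omega> in M. limit_vector p \<sigma> \<omega> = 0) = 0
    \<and> transient M (walk \<sigma>)"
proof -
  interpret elephant_random_walk M p k \<tau> \<sigma> by fact
  define a where "a = scaling_exponent CARD('d) p"
  interpret R: linear_reinforcement M stage "\<lambda>n \<omega>. coord i (\<sigma> n \<omega>)" a "2 * min p q" for i
    unfolding a_def by (rule coordinate_reinforcement) fact
  have X_walk: "AE \<omega> in M. \<forall>n i. R.X i n \<omega> = walk \<sigma> n \<omega> $ i"
    using steps_AE
    by eventually_elim (unfold R.X_def walk_def, auto simp: coord_def)
  have "AE \<omega> in M. \<forall>i. (\<lambda>n. R.X i n \<omega> / real n powr a) \<longlonglongrightarrow> R.Y i \<omega>"
    unfolding AE_all_countable using R.rescaled_tendsto by blast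
  then have lim: "AE \<omega> in M. (\<lambda>n. rescaled_walk p \<sigma> n \<omega>) \<longlonglongrightarrow> (\<chi> i. R.Y i \<omega>)"
    using X_walk
  proof eventually_elim
    case (elim \<omega>)
    show ?case
    proof (rule vec_tendstoI)
      fix i
      show "(\<lambda>n. rescaled_walk p \<sigma> n \<omega> $ i) \<longlonglongrightarrow> (\<chi> i. R.Y i \<omega>) $ i"
        using elim(1)[rule_format, of i] elim(2)
        by (simp add: rescaled_walk_def a_def[symmetric] divide_inverse mult.commute)
    qed
  qed
  have Y_lim: "AE \<omega> in M. limit_vector p \<sigma> \<omega> = (\<chi> i. R.Y i \<omega>)"
    using lim by eventually_elim (simp add: limit_vector_def limI)
  have conv: "AE \<omega> in M. (\<lambda>n. rescaled_walk p \<sigma> n \<omega>) \<longlonglongrightarrow> limit_vector p \<sigma> \<omega>"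
    using lim Y_lim by eventually_elim simp
  have p_pos: "0 < p"
  proof -
    have "0 \<le> critical_param CARD('d)" by (simp add: critical_param_def)
    then show ?thesis using assms(2) by linarith
  qed
  have "AE \<omega> in M. R.Y k \<omega> \<noteq> 0"
  \<comment> \<open>For \<open>p = 1\<close> the lower bound on the noise is 0 and the mean position is used instead.\<close>
  proof (cases "p = 1")
    case True
    then have "a = 1" using dim_pos by (simp add: a_def scaling_exponent_def)
    moreover have "coord k (\<sigma> 1 \<omega>) = 1" if "\<omega> \<in> space M" for \<omega>
      using first_step[OF that] by (auto simp: coord_def unit_steps_def)
    ultimately have "AE \<omega> in M. R.Y k \<omega> = 1" by (rule R.limit_full_memory)
    then show ?thesis by eventually_elim simp
  next
    case False
    then have "0 < 2 * min p q" using p_pos p_range dim_pos by (simp add: q_def)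
    then show ?thesis by (rule R.limit_nonzero)
  qed
  then have nz: "AE \<omega> in M. limit_vector p \<sigma> \<omega> \<noteq> 0"
    using Y_lim by eventually_elim (auto simp: vec_eq_iff)
  have "\<P>(\<omega> in M. limit_vector p \<sigma> \<omega> = 0) = 0"
  \<comment> \<open>A set that is not measurable has measure 0 by convention.\<close>
  proof (cases "{\<omega>\<in>space M. limit_vector p \<sigma> \<omega> = 0} \<in> sets M")
    case True
    then show ?thesis using nz by (subst prob_eq_0) (auto elim: eventually_mono)
  qed (rule measure_notin_sets)
  moreover have "transient M (walk \<sigma>)"
    unfolding transient_def
  proof (intro allI impI)
    fix x :: "real^'d"
    have [measurable]: "walk \<sigma> n \<in> borel_measurable M" for n
      unfolding walk_def by (intro borel_measurable_sum measurable_step) auto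
    have "AE \<omega> in M. finite {n. walk \<sigma> n \<omega> = x}"
      using conv nz
    proof eventually_elim
      case (elim \<omega>)
      \<comment> \<open>A path that visits x infinitely often has a rescaled subsequence tending to 0.\<close>
      have "(\<lambda>n. 1 / real n powr a) \<longlonglongrightarrow> 0"
        using R.exponent(1) by real_asymp
      then have "(\<lambda>n. rescaled_walk p \<sigma> n \<omega> - (1 / real n powr a) *\<^sub>R x) \<longlonglongrightarrow> limit_vector p \<sigma> \<omega> - 0 *\<^sub>R x"
        by (intro tendsto_intros elim)
      then have "eventually (\<lambda>n. rescaled_walk p \<sigma> n \<omega> - (1 / real n powr a) *\<^sub>R x \<noteq> 0) sequentially"
        by (rule tendsto_imp_eventually_ne) (use elim in simp)
      then have "eventually (\<lambda>n. walk \<sigma> n \<omega> \<noteq> x) sequentially"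
        by eventually_elim (auto simp: rescaled_walk_def a_def inverse_eq_divide)
      then show ?case
        by (simp add: eventually_cofinite cofinite_eq_sequentially[symmetric])
    qed
    moreover have "{\<omega>\<in>space M. finite {n. walk \<sigma> n \<omega> = x}} \<in> sets M"
    proof -
      have "finite {n. walk \<sigma> n \<omega> = x} \<longleftrightarrow> (\<exists>m. \<forall>n\<ge>m. walk \<sigma> n \<omega> \<noteq> x)" for \<omega>
        using eventually_cofinite[of "\<lambda>n. walk \<sigma> n \<omega> \<noteq> x"]
        by (simp add: cofinite_eq_sequentially eventually_sequentially)
      then show ?thesis by simp measurable
    qed
    ultimately show "\<P>(\<omega> in M. finite {n. walk \<sigma> n \<omega> = x}) = 1"
      by (subst prob_Collect_eq_1) auto
  qed
  ultimately show ?thesis using conv by simp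
qed

end
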